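(* Let $v$ be a weighted game on $n$ voters whose voters form $k$ nontrivial symmetry classes, and let $d$ be the degree of $v$ in the Hasse diagram of $\mathcal W_n$. Then the closure of $P_v$ has $n-k+d$ facets. Moreover: (1) If $v\neq\langle N\rangle$, the top facets of $P_v$ are in one-to-one correspondence with the weighted games $u$ covering $v$ in $\mathcal W_n$; the facet corresponding to $u$ lies in the hyperplane $h_A$, where $A$ is the unique coalition winning in $v$ but not in $u$, and $A$ is a shift-minimal winning coalition of $v$. If $v=\langle N\rangle$ (only $N$ wins), $P_v$ has exactly one top facet, lying in $\{q=1\}$. (2) If $v\neq\langle 1\rangle$, the bottom facets of $P_v$ are in one-to-one correspondence with the weighted games $g$ covered by $v$ in $\mathcal W_n$; the facet corresponding to $g$ lies in $h_B$, where $B$ is the unique coalition winning in $g$ but not in $v$, and $B$ is a shift-maximal losing coalition of $v$. If $v=\langle 1\rangle$ (every nonempty coalition wins), $P_v$ has exactly one bottom facet, lying in $\{q=0\}$. (3) $P_v$ has exactly $n-k$ vertical facets, each lying above a face of $\Delta_n$ given by $w_{i+1}=w_i$ for some $1\le i\le n-1$, or by $w_1=0$.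
   Context: Let $N=\{1,\dots,n\}$. A simple game is a family $W$ of subsets of $N$ (winning coalitions) with $N\in W$, $\emptyset\notin W$, closed under supersets. Order subsets of $N$ (poset $M(n)$) by: for $A=\{a_1>\dots>a_k\}$, $B=\{b_1>\dots>b_j\}$, $B\ge A$ iff $k\le j$ and $b_i\ge a_i$ for $i\le k$. Shift-minimal winning coalitions of $v$ are the minimal elements of $W_v$ in $M(n)$; shift-maximal losing coalitions are the maximal elements of its complement. Let $\Delta_n=\{\mathbf w=(w_n,\dots,w_1): w_n\ge\dots\ge w_1\ge0,\ \sum_i w_i=1\}$, $\mathcal C_n=(0,1]\times\Delta_n$. A weighted game is a simple game $v$ such that some $(q:\mathbf w)\in\mathcal C_n$ satisfies: $A\in W_v$ iff $w_A:=\sum_{i\in A}w_i\ge q$ (a realization); $P_v$ is the set of realizations of $v$. For a coalition $A$, $h_A=\{(q:\mathbf w): q=w_A\}$. The closure $\overline{P_v}$ is an $n$-dimensional convex polytope in the affine space $\mathbb R\times\{\sum_i w_i=1\}$; its facets are of three types: top facets (contained in $h_A$ for some winning coalition $A$ of $v$), bottom facets (contained in $h_B$ for a losing coalition $B$ of $v$, including $B=\emptyset$, i.e. $\{q=0\}$), and vertical facets (contained in $\mathbb R\times\tau$ for a codimension-one face $\tau$ of $\Delta_n$). $\mathcal W_n$ is the poset of weighted games on $n$ voters with order generated by the covering relation: $u$ covers $v$ iff both are weighted and $W_v=W_u\cup\{A\}$ for a single $A\notin W_u$; the degree of $v$ is the number of weighted games covering $v$ plus the number covered by $v$. Voters $i,j$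 are in the same symmetry class if for all $S\subseteq N\setminus\{i,j\}$, $S\cup\{i\}\in W_v$ iff $S\cup\{j\}\in W_v$; a dummy is a voter in no minimal winning coalition; the nontrivial symmetry classes are the symmetry classes of non-dummy voters.
   Formalization: The total count n-k+d fails for v=⟨N⟩ and v=⟨1⟩ (e.g. n=2, v=⟨N⟩: a triangle, but n-k+d=2); the formal count is n-k+d, plus 1 if v=⟨N⟩ and plus 1 if v=⟨1⟩, so it is n-k+d for all other v. *)

theory Defs
  imports "HOL-Analysis.Analysis"
begin

text \<open>
  The voters \<open>1 < \<dots> < n\<close> are the elements of a finite linearly ordered type \<open>'n\<close>, so
  \<open>N = UNIV\<close> and \<open>n = CARD('n)\<close>. A game is identified with its family of winning coalitions.
\<close>

subsection \<open>Simple games\<close>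

definition simple_game :: "'n set set \<Rightarrow> bool" where
  "simple_game W \<longleftrightarrow> UNIV \<in> W \<and> {} \<notin> W \<and> (\<forall>A B. A \<in> W \<and> A \<subseteq> B \<longrightarrow> B \<in> W)"

definition descending :: "'n::{finite,linorder} set \<Rightarrow> 'n list" where
  "descending A = rev (sorted_list_of_set A)"

definition shift_le :: "'n::{finite,linorder} set \<Rightarrow> 'n set \<Rightarrow> bool" where
  "shift_le A B \<longleftrightarrow>
     card A \<le> card B \<and> (\<forall>i<card A. descending A ! i \<le> descending B ! i)"

definition shift_minimal_winning :: "'n::{finite,linorder} set set \<Rightarrow> 'n set \<Rightarrow> bool" where
  "shift_minimal_winning W A \<longleftrightarrow> A \<in> W \<and> (\<forall>C. C \<in> W \<and> shift_le C A \<longrightarrow> C = A)"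

definition shift_maximal_losing :: "'n::{finite,linorder} set set \<Rightarrow> 'n set \<Rightarrow> bool" where
  "shift_maximal_losing W B \<longleftrightarrow> B \<notin> W \<and> (\<forall>C. C \<notin> W \<and> shift_le B C \<longrightarrow> C = B)"

definition minimal_winning :: "'n set set \<Rightarrow> 'n set \<Rightarrow> bool" where
  "minimal_winning W A \<longleftrightarrow> A \<in> W \<and> (\<forall>B. B \<subset> A \<longrightarrow> B \<notin> W)"

definition dummy :: "'n set set \<Rightarrow> 'n \<Rightarrow> bool" where
  "dummy W i \<longleftrightarrow> (\<forall>A. minimal_winning W A \<longrightarrow> i \<notin> A)"

definition same_class :: "'n set set \<Rightarrow> ('n \<times> 'n) set" where
  "same_class W = {(i, j). \<forall>S. S \<subseteq> UNIV - {i, j} \<longrightarrow> (S \<union> {i} \<in> W \<longleftrightarrow> S \<union> {j} \<in> W)}"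

definition nontrivial_classes :: "'n set set \<Rightarrow> 'n set set" where
  "nontrivial_classes W = {i. \<not> dummy W i} // same_class W"


subsection \<open>Weighted games and their realizations\<close>

definition weight :: "real ^ 'n::finite \<Rightarrow> 'n set \<Rightarrow> real" where
  "weight w A = (\<Sum>i\<in>A. w $ i)"

definition weight_simplex :: "(real ^ 'n::{finite,linorder}) set" where
  "weight_simplex =
     {w. (\<forall>i j. i \<le> j \<longrightarrow> w $ i \<le> w $ j) \<and> (\<forall>i. 0 \<le> w $ i) \<and> (\<Sum>i\<in>UNIV. w $ i) = 1}"

definition config_space :: "(real \<times> (real ^ 'n::{finite,linorder})) set" where
  "config_space = {0<..1} \<times> weight_simplex"

definition realizations ::
    "'n::{finite,linorder} set set \<Rightarrow> (real \<times> (real ^ 'n::{finite,linorder})) set" where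
  "realizations W = {(q, w) \<in> config_space. \<forall>A. A \<in> W \<longleftrightarrow> weight w A \<ge> q}"

definition weighted :: "'n::{finite,linorder} set set \<Rightarrow> bool" where
  "weighted W \<longleftrightarrow> simple_game W \<and> realizations W \<noteq> {}"

definition coalition_hyperplane ::
    "'n::finite set \<Rightarrow> (real \<times> (real ^ 'n::finite)) set" where
  "coalition_hyperplane A = {(q, w). (\<Sum>i\<in>UNIV. w $ i) = 1 \<and> q = weight w A}"


subsection \<open>The Hasse diagram of weighted games\<close>

text \<open>The game with fewer winning coalitions is the larger one.\<close>

definition covers :: "'n::{finite,linorder} set set \<Rightarrow> 'n set set \<Rightarrow> bool" where
  "covers U V \<longleftrightarrow> weighted U \<and> weighted V \<and> (\<exists>A. A \<notin> U \<and> V = U \<union> {A})"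

definition degree :: "'n::{finite,linorder} set set \<Rightarrow> nat" where
  "degree W = card {U. covers U W} + card {G. covers W G}"


subsection \<open>Facets of the realization polytope\<close>

definition facets ::
    "'n::{finite,linorder} set set \<Rightarrow> (real \<times> (real ^ 'n::{finite,linorder})) set set" where
  "facets W = {F. F facet_of closure (realizations W)}"

definition top_facets ::
    "'n::{finite,linorder} set set \<Rightarrow> (real \<times> (real ^ 'n::{finite,linorder})) set set" where
  "top_facets W = {F \<in> facets W. \<exists>A. A \<in> W \<and> F \<subseteq> coalition_hyperplane A}"

definition bottom_facets ::
    "'n::{finite,linorder} set set \<Rightarrow> (real \<times> (real ^ 'n::{finite,linorder})) set set" where
  "bottom_facets W = {F \<in> facets W. \<exists>B. B \<notin> W \<and> F \<subseteq> coalition_hyperplane B}"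

definition vertical_facets ::
    "'n::{finite,linorder} set set \<Rightarrow> (real \<times> (real ^ 'n::{finite,linorder})) set set" where
  "vertical_facets W =
     {F \<in> facets W. \<exists>\<tau>. \<tau> facet_of weight_simplex \<and> F \<subseteq> UNIV \<times> \<tau>}"

text \<open>
  The faces \<open>w\<^sub>i\<^sub>+\<^sub>1 = w\<^sub>i\<close> (for consecutive voters \<open>i\<close>, \<open>j\<close> in the order of \<open>'n\<close>) and
  \<open>w\<^sub>1 = 0\<close> (for the least voter) of the weight simplex.
\<close>

definition equal_weights_face ::
    "'n::{finite,linorder} \<Rightarrow> 'n \<Rightarrow> (real ^ 'n::{finite,linorder}) set" where
  "equal_weights_face i j = {w \<in> weight_simplex. w $ j = w $ i}"

definition zero_weight_face :: "(real ^ 'n::{finite,linorder}) set" where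
  "zero_weight_face = {w \<in> weight_simplex. w $ (Min UNIV) = 0}"

definition consecutive :: "'n::linorder \<Rightarrow> 'n \<Rightarrow> bool" where
  "consecutive i j \<longleftrightarrow> i < j \<and> (\<forall>l. \<not> (i < l \<and> l < j))"


subsection \<open>The two extreme games\<close>

text \<open>
  Since \<open>N \<in> W\<close> and \<open>{} \<notin> W\<close> for simple games, the unanimity game is covered by no game although
  its polytope has a top facet in \<open>q = 1\<close>; dually, the game in which every nonempty coalition wins
  covers no game although its polytope has a bottom facet in \<open>q = 0\<close>. The degree does not count
  these facets, so a facet count in terms of the degree must add them separately.
\<close>

definition unanimity_game :: "'n set set" where
  "unanimity_game = {UNIV}"

definition any_voter_game :: "'n set set" where
  "any_voter_game = {A. A \<noteq> {}}"

end

theory Submission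
  imports Defs
begin

text \<open>
  The closure of \<open>P\<^sub>v\<close> is cut out of the affine space \<open>\<Sum>w\<^sub>i = 1\<close> by finitely many homogeneous
  linear inequalities, no two of which define the same hyperplane: one for each coalition, with sign
  given by winning or losing, and one for each face of the simplex. For such a system with a strict
  solution, the facets are the tight loci of the essential inequalities, those that can be made
  tight while all others stay strict. A coalition \<open>A\<close> other than \<open>N\<close> and \<open>\<emptyset>\<close> is essential iff changing
  its status gives a weighted game: a point of the facet can be pushed across the hyperplane, and
  conversely the segment between strict realizations of the two games crosses only \<open>h\<^sub>A\<close>.
  A simplex inequality is essential iff its voter is interchangeable with the preceding voter (or,
  for the least voter, is a dummy). So the inessential ones belong to the least members of the
  nontrivial classes, which leaves \<open>n - k\<close> vertical facets.
\<close>

subsection \<open>Facets of systems of linear inequalities\<close>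

lemma linear_tendsto_mix:
  fixes f :: "'a::real_vector \<Rightarrow> real"
  assumes "linear f"
  shows "((\<lambda>t. f ((1 - t) *\<^sub>R x + t *\<^sub>R y)) \<longlongrightarrow> f x) (at_right 0)"
proof -
  have "((\<lambda>t. (1 - t) * f x + t * f y) \<longlongrightarrow> (1 - 0) * f x + 0 * f y) (at_right (0::real))"
    by (intro tendsto_intros)
  then show ?thesis
    using assms by (simp add: linear_add linear_scale)
qed

text \<open>A form positive at \<open>x\<close> stays positive near \<open>x\<close> by continuity.
  A form vanishing at \<open>x\<close> becomes positive as soon as a positive share of
  \<open>y\<close> is mixed in. Finitely many forms admit a common bound on
  \<open>t\<close>.\<close>

lemma eventually_mix_positive:
  fixes f :: "'i \<Rightarrow> 'a::real_vector \<Rightarrow> real"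
  assumes "finite I"
    and "\<And>i. i \<in> I \<Longrightarrow> linear (f i)"
    and "\<And>i. i \<in> I \<Longrightarrow> 0 < f i x \<or> (0 \<le> f i x \<and> 0 < f i y)"
  shows "\<forall>\<^sub>F t in at_right 0. t < 1 \<and> (\<forall>i\<in>I. 0 < f i ((1 - t) *\<^sub>R x + t *\<^sub>R y))"
proof -
  have lt1: "\<forall>\<^sub>F t in at_right (0::real). t < 1"
    using eventually_at_right_real[of 0 1] by (auto elim: eventually_mono)
  have "\<forall>\<^sub>F t in at_right 0. 0 < f i ((1 - t) *\<^sub>R x + t *\<^sub>R y)" if i: "i \<in> I" for i
  proof (cases "0 < f i x")
    case True
    then show ?thesis
      using order_tendstoD(1)[OF linear_tendsto_mix[OF assms(2)[OF i]]] by blast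
  next
    case False
    with assms(3)[OF i] have "0 \<le> f i x" "0 < f i y" by auto
    have "\<forall>\<^sub>F t in at_right (0::real). 0 < t"
      by (simp add: eventually_at_right_less)
    from this lt1 show ?thesis
    proof eventually_elim
      case (elim t)
      then show ?case
        using \<open>0 \<le> f i x\<close> \<open>0 < f i y\<close> assms(2)[OF i]
        by (simp add: linear_add linear_scale add_nonneg_pos)
    qed
  qed
  with assms(1) have "\<forall>\<^sub>F t in at_right 0. \<forall>i\<in>I. 0 < f i ((1 - t) *\<^sub>R x + t *\<^sub>R y)"
    by (simp add: eventually_ball_finite)
  with lt1 show ?thesis
    by (rule eventually_conj)
qed

corollary mix_positive:
  fixes f :: "'i \<Rightarrow> 'a::real_vector \<Rightarrow> real"
  assumes "finite I"
    and "\<And>i. i \<in> I \<Longrightarrow> linear (f i)"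
    and "\<And>i. i \<in> I \<Longrightarrow> 0 < f i x \<or> (0 \<le> f i x \<and> 0 < f i y)"
  shows "\<exists>t. 0 < t \<and> t < 1 \<and> (\<forall>i\<in>I. 0 < f i ((1 - t) *\<^sub>R x + t *\<^sub>R y))"
proof -
  have "\<forall>\<^sub>F t in at_right 0. t < 1 \<and> (\<forall>i\<in>I. 0 < f i ((1 - t) *\<^sub>R x + t *\<^sub>R y))"
    using assms by (rule eventually_mix_positive)
  moreover have "\<forall>\<^sub>F t in at_right (0::real). 0 < t"
    by (simp add: eventually_at_right_less)
  ultimately
  have "\<forall>\<^sub>F t in at_right 0. 0 < t \<and> t < 1 \<and> (\<forall>i\<in>I. 0 < f i ((1 - t) *\<^sub>R x + t *\<^sub>R y))"
    by eventually_elim auto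
  from eventually_happens[OF this] show ?thesis
    by (simp add: trivial_limit_at_right_real)
qed

lemma linear_as_inner:
  fixes f :: "'a::euclidean_space \<Rightarrow> real"
  assumes "linear f"
  obtains a where "f = (\<lambda>x. a \<bullet> x)"
proof
  show "f = (\<lambda>x. adjoint f 1 \<bullet> x)"
    using adjoint_works[OF assms, of _ 1] by (auto simp: inner_commute)
qed

text \<open>In both uses below \<open>H\<close> is an affine space of total weight 1. The last
  assumption says that no zero section is contained in another. Its premise excepts forms without a
  zero on \<open>H\<close>, such as the weight of the only voter when there is just one.\<close>

locale linear_system =
  fixes H :: "'a::euclidean_space set"
    and I :: "'i set"
    and f :: "'i \<Rightarrow> 'a \<Rightarrow> real"
  assumes affine_H: "affine H"
    and finite_I: "finite I"
    and linear_f: "\<And>i. i \<in> I \<Longrightarrow> linear (f i)"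
    and strictly_feasible: "\<exists>x\<in>H. \<forall>i\<in>I. 0 < f i x"
    and nonproportional:
      "\<And>i j. \<lbrakk>i \<in> I; j \<in> I; i \<noteq> j; \<exists>x\<in>H. f i x = 0\<rbrakk> \<Longrightarrow> \<exists>x\<in>H. f i x = 0 \<and> f j x \<noteq> 0"
begin

definition solutions :: "'a set" where
  "solutions = {x \<in> H. \<forall>i\<in>I. 0 \<le> f i x}"

definition tight :: "'i \<Rightarrow> 'a set" where
  "tight i = {x \<in> solutions. f i x = 0}"

definition essential :: "'i set" where
  "essential = {i \<in> I. \<exists>x\<in>H. f i x = 0 \<and> (\<forall>j\<in>I - {i}. 0 < f j x)}"

lemma convex_solutions: "convex solutions"
proof -
  have "solutions = H \<inter> (\<Inter>i\<in>I. {x. 0 \<le> f i x})"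
    by (auto simp: solutions_def)
  moreover have "convex {x. 0 \<le> f i x}" if "i \<in> I" for i
    using linear_as_inner[OF linear_f[OF that]] convex_halfspace_ge by metis
  ultimately show ?thesis
    using affine_H by (simp add: affine_imp_convex convex_INT convex_Int)
qed

lemma open_positive: "J \<subseteq> I \<Longrightarrow> open {x. \<forall>i\<in>J. 0 < f i x}"
proof -
  assume J: "J \<subseteq> I"
  have "{x. \<forall>i\<in>J. 0 < f i x} = (\<Inter>i\<in>J. {x. 0 < f i x})"
    by auto
  moreover have "open {x. 0 < f i x}" if "i \<in> J" for i
    using linear_as_inner[OF linear_f[of i]] open_halfspace_gt that J by (metis subsetD)
  ultimately show ?thesis
    using finite_subset[OF J finite_I] by (simp add: open_INT)
qed

lemma affine_hull_positive_part:
  assumes "J \<subseteq> I" "affine C" "x \<in> C" "\<And>i. i \<in> J \<Longrightarrow> 0 < f i x"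
  shows "affine hull (C \<inter> {x. \<forall>i\<in>J. 0 < f i x}) = C"
proof -
  have "C \<inter> {x. \<forall>i\<in>J. 0 < f i x} \<noteq> {}"
    using assms by auto
  then show ?thesis
    using affine_hull_affine_Int_open[OF assms(2) open_positive[OF assms(1)]] assms(2)
    by (simp add: affine_hull_eq)
qed

text \<open>A nonempty relatively open part of \<open>C\<close> already spans \<open>C\<close>, so
  any \<open>S\<close> between the two has full dimension. It serves for \<open>solutions\<close>
  inside \<open>H\<close> and for a tight locus inside its zero section.\<close>

lemma aff_dim_eq_of_positive_part:
  assumes "J \<subseteq> I" "affine C" "x \<in> C" "\<And>i. i \<in> J \<Longrightarrow> 0 < f i x"
    and "C \<inter> {x. \<forall>i\<in>J. 0 < f i x} \<subseteq> S" "S \<subseteq> C"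
  shows "aff_dim S = aff_dim C"
proof -
  let ?U = "{x. \<forall>i\<in>J. 0 < f i x}"
  have "affine hull (C \<inter> ?U) = C"
    using assms(1-4) by (rule affine_hull_positive_part)
  then have "aff_dim C \<le> aff_dim S"
    using aff_dim_subset[OF assms(5)] aff_dim_affine_hull by metis
  with aff_dim_subset[OF assms(6)] show ?thesis
    by simp
qed

lemma aff_dim_solutions: "aff_dim solutions = aff_dim H"
proof -
  obtain x where "x \<in> H" "\<And>i. i \<in> I \<Longrightarrow> 0 < f i x"
    using strictly_feasible by auto
  then show ?thesis
    by (intro aff_dim_eq_of_positive_part[of I]) (auto simp: affine_H solutions_def less_imp_le)
qed

lemma tight_face:
  assumes "i \<in> I"
  shows "tight i face_of solutions"
proof -
  obtain a where a: "f i = (\<lambda>x. a \<bullet> x)"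
    using linear_as_inner[OF linear_f[OF assms]] by metis
  have "solutions \<inter> {x. a \<bullet> x = 0} face_of solutions"
    using assms a
    by (intro face_of_Int_supporting_hyperplane_ge convex_solutions) (auto simp: solutions_def fun_eq_iff)
  moreover have "solutions \<inter> {x. a \<bullet> x = 0} = tight i"
    by (auto simp: tight_def a)
  ultimately show ?thesis
    by simp
qed

text \<open>The strict point lies in \<open>H\<close> but off the hyperplane, so the hyperplane cuts
  \<open>H\<close> properly and the dimension drops by exactly one.\<close>

lemma zero_section:
  assumes "i \<in> I" "x \<in> H" "f i x = 0"
  shows "affine {x \<in> H. f i x = 0}" "aff_dim {x \<in> H. f i x = 0} = aff_dim H - 1"
proof -
  obtain a where a: "f i = (\<lambda>x. a \<bullet> x)"
    using linear_as_inner[OF linear_f[OF assms(1)]] by metis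
  have eq: "{x \<in> H. f i x = 0} = H \<inter> {x. a \<bullet> x = 0}"
    by (auto simp: a)
  show "affine {x \<in> H. f i x = 0}"
    unfolding eq by (intro affine_Int affine_H affine_hyperplane)
  have "\<not> H \<subseteq> {x. a \<bullet> x = 0}"
    using strictly_feasible assms(1) a by force
  moreover have "H \<inter> {x. a \<bullet> x = 0} \<noteq> {}"
    using assms a by auto
  ultimately show "aff_dim {x \<in> H. f i x = 0} = aff_dim H - 1"
    unfolding eq using aff_dim_affine_Int_hyperplane[OF affine_H, of a 0] by simp
qed

lemma essential_strict_point:
  assumes "i \<in> essential"
  obtains x where "x \<in> tight i" "\<And>j. \<lbrakk>j \<in> I; j \<noteq> i\<rbrakk> \<Longrightarrow> 0 < f j x"
proof -
  obtain x where "x \<in> H" "f i x = 0" and pos: "\<forall>j\<in>I - {i}. 0 < f j x"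
    using assms by (auto simp: essential_def)
  moreover have "0 \<le> f j x" if "j \<in> I" for j
    using that \<open>f i x = 0\<close> pos by (cases "j = i") (auto simp: less_imp_le)
  ultimately have "x \<in> tight i"
    by (auto simp: tight_def solutions_def)
  with pos show ?thesis
    by (intro that[of x]) auto
qed

text \<open>Near the strict point of an essential constraint only that constraint is active, so the
  tight locus fills an open part of the zero section.\<close>

lemma tight_facet:
  assumes "i \<in> essential"
  shows "tight i facet_of solutions"
proof -
  have i: "i \<in> I"
    using assms by (simp add: essential_def)
  obtain x where x: "x \<in> tight i" "\<And>j. \<lbrakk>j \<in> I; j \<noteq> i\<rbrakk> \<Longrightarrow> 0 < f j x"
    using essential_strict_point[OF assms] by blast
  then have xH: "x \<in> H" "f i x = 0"
    by (auto simp: tight_def solutions_def)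
  have "aff_dim (tight i) = aff_dim {x \<in> H. f i x = 0}"
  proof (rule aff_dim_eq_of_positive_part[of "I - {i}" _ x])
    show "{x \<in> H. f i x = 0} \<inter> {x. \<forall>j\<in>I - {i}. 0 < f j x} \<subseteq> tight i"
      by (force simp: tight_def solutions_def intro: less_imp_le)
  qed (use x xH zero_section[OF i xH] in \<open>auto simp: tight_def solutions_def\<close>)
  then show ?thesis
    using tight_face[OF i] x zero_section[OF i xH] aff_dim_solutions
    by (auto simp: facet_of_def)
qed

text \<open>At a relative interior point \<open>y\<close> the segment from \<open>z\<close> can be
  prolonged beyond \<open>y\<close> inside \<open>F\<close>. A positive value at \<open>z\<close>
  would then become negative on the prolongation.\<close>

lemma vanishes_on_face:
  assumes "i \<in> I" "F \<subseteq> solutions" "y \<in> rel_interior F" "f i y = 0" "z \<in> F"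
  shows "f i z = 0"
proof -
  obtain a where a: "f i = (\<lambda>x. a \<bullet> x)"
    using linear_as_inner[OF linear_f[OF assms(1)]] by metis
  obtain e where e: "e > 0" "ball y e \<inter> affine hull F \<subseteq> F" and yF: "y \<in> F"
    using assms(3) by (auto simp: mem_rel_interior_ball)
  \<comment> \<open>With this step length the prolonged point stays within \<open>e\<close> of
    \<open>y\<close>; the added 1 keeps the denominator positive when \<open>z = y\<close>.\<close>
  define t where "t = e / (2 * (norm (y - z) + 1))"
  have t: "t > 0" using e by (simp add: t_def add_nonneg_pos)
  have "t * norm (y - z) < e"
  proof -
    have "norm (y - z) / (2 * (norm (y - z) + 1)) < 1"
      by (smt (verit) divide_less_eq_1 norm_ge_zero)
    then have "e * (norm (y - z) / (2 * (norm (y - z) + 1))) < e * 1"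
      using e(1) by (rule mult_strict_left_mono)
    then show ?thesis by (simp add: t_def)
  qed
  \<comment> \<open>The point \<open>u\<close> is \<open>y\<close> pushed away from
    \<open>z\<close>. Since \<open>f i\<close> vanishes at \<open>y\<close>, its value there is
    \<open>- t * f i z\<close>.\<close>
  define u where "u = (1 + t) *\<^sub>R y + (- t) *\<^sub>R z"
  have "u - y = t *\<^sub>R (y - z)"
    by (simp add: u_def algebra_simps)
  then have "dist y u < e"
    using \<open>t * norm (y - z) < e\<close> t by (simp add: dist_norm norm_minus_commute)
  moreover have "u \<in> affine hull F"
    unfolding u_def using yF assms(5)
    by (intro mem_affine affine_affine_hull) (auto simp: hull_inc)
  ultimately have "u \<in> F"
    using e by auto
  then have "0 \<le> f i u"
    using assms by (auto simp: solutions_def)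
  then have "t * f i z \<le> 0"
    using assms(4) by (simp add: a u_def inner_add_right inner_diff_right algebra_simps)
  moreover have "0 \<le> f i z"
    using assms by (auto simp: solutions_def)
  ultimately show ?thesis
    using t by (simp add: mult_le_0_iff)
qed

text \<open>The constraints active at a relative interior point \<open>y\<close> of the facet decide
  everything: one is active by dimension, and a second one would vanish on the whole zero section of
  the first, against nonproportionality.\<close>

lemma facet_is_tight:
  assumes "F facet_of solutions"
  obtains i where "i \<in> essential" "F = tight i"
proof -
  have F: "F face_of solutions" "F \<noteq> {}" "aff_dim F = aff_dim H - 1"
    using assms aff_dim_solutions by (auto simp: facet_of_def)
  have "F \<subseteq> solutions" "convex F"
    using F face_of_imp_subset face_of_imp_convex by auto
  with F(2) obtain y where y: "y \<in> rel_interior F"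
    using rel_interior_eq_empty by auto
  have yS: "y \<in> F" "y \<in> H" "\<And>i. i \<in> I \<Longrightarrow> 0 \<le> f i y"
    using y rel_interior_subset[of F] \<open>F \<subseteq> solutions\<close> by (auto simp: solutions_def)
  \<comment> \<open>Otherwise \<open>y\<close> is relatively interior to \<open>solutions\<close>,
    and a face meeting the relative interior is the whole set, which has too large a
    dimension.\<close>
  have "\<exists>i\<in>I. f i y = 0"
  proof (rule ccontr)
    assume "\<not> ?thesis"
    then have pos: "0 < f i y" if "i \<in> I" for i
      using yS(3)[OF that] that by force
    have "H \<inter> {x. \<forall>i\<in>I. 0 < f i x} \<subseteq> solutions"
      by (auto simp: solutions_def less_imp_le)
    moreover have "affine hull solutions = H"
    proof
      show "affine hull solutions \<subseteq> H"
        using affine_H by (intro hull_minimal) (auto simp: solutions_def)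
      have "affine hull (H \<inter> {x. \<forall>i\<in>I. 0 < f i x}) = H"
        using pos yS(2) affine_H by (intro affine_hull_positive_part) auto
      then show "H \<subseteq> affine hull solutions"
        using hull_mono[OF calculation] by metis
    qed
    ultimately have "y \<in> rel_interior solutions"
      unfolding mem_rel_interior using pos yS open_positive[of I] by (auto simp: Int_commute)
    then have "F = solutions"
      using face_of_disjoint_rel_interior[OF F(1)] yS by auto
    then show False
      using F(3) aff_dim_solutions by simp
  qed
  then obtain i where i: "i \<in> I" "f i y = 0" by auto
  let ?Z = "{x \<in> H. f i x = 0}"
  note Z = zero_section[OF i(1) yS(2) i(2)]
  have FZ: "F \<subseteq> ?Z"
    using vanishes_on_face[OF i(1) \<open>F \<subseteq> solutions\<close> y i(2)] \<open>F \<subseteq> solutions\<close>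
    by (auto simp: solutions_def)
  \<comment> \<open>Both have dimension one less than \<open>H\<close>, so \<open>F\<close> spans
    the section.\<close>
  have hull: "affine hull F = ?Z"
    using Z F(2,3) FZ by (intro affine_dim_equal affine_affine_hull hull_minimal) auto
  have "0 < f j y" if j: "j \<in> I - {i}" for j
  proof (rule ccontr)
    assume "\<not> 0 < f j y"
    then have "f j y = 0"
      using yS(3) j by force
    then have "F \<subseteq> {x \<in> H. f j x = 0}"
      using vanishes_on_face[OF _ \<open>F \<subseteq> solutions\<close> y] j \<open>F \<subseteq> solutions\<close>
      by (auto simp: solutions_def)
    moreover have "affine {x \<in> H. f j x = 0}"
      using zero_section(1) j yS \<open>f j y = 0\<close> by auto
    ultimately have "?Z \<subseteq> {x \<in> H. f j x = 0}"
      unfolding hull[symmetric] by (rule hull_minimal)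
    then show False
      using nonproportional[of i j] i j yS by auto
  qed
  then have "i \<in> essential"
    using i yS by (auto simp: essential_def)
  \<comment> \<open>A proper face of \<open>tight i\<close> would have smaller dimension than
    \<open>F\<close> has.\<close>
  moreover have "F = tight i"
  proof (rule ccontr)
    assume "F \<noteq> tight i"
    moreover have "F \<subseteq> tight i" "tight i \<subseteq> solutions"
      using FZ \<open>F \<subseteq> solutions\<close> by (auto simp: tight_def)
    then have "F face_of tight i"
      using F(1) face_of_subset by blast
    moreover have "convex (tight i)"
      using tight_face[OF i(1)] face_of_imp_convex by auto
    ultimately have "aff_dim F < aff_dim (tight i)"
      by (intro face_of_aff_dim_lt) auto
    then show False
      using tight_facet[OF \<open>i \<in> essential\<close>] F(3) aff_dim_solutions by (auto simp: facet_of_def)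
  qed
  ultimately show ?thesis
    using that by blast
qed

theorem facet_of_solutions_iff: "F facet_of solutions \<longleftrightarrow> F \<in> tight ` essential"
  using tight_facet facet_is_tight by blast

text \<open>The strict point of \<open>i\<close> refutes any other \<open>j\<close>. This recovers
  the index of a facet from any constraint hyperplane that contains it.\<close>

lemma essential_vanishing:
  assumes "i \<in> essential" "j \<in> I" "\<And>x. x \<in> tight i \<Longrightarrow> f j x = 0"
  shows "j = i"
proof (rule ccontr)
  assume "j \<noteq> i"
  with essential_strict_point[OF assms(1)] assms(2) obtain x where "x \<in> tight i" "0 < f j x"
    by metis
  with assms(3) show False by force
qed

lemma inj_on_tight: "inj_on tight essential"
proof (rule inj_onI)
  fix i j assume "i \<in> essential" "j \<in> essential" "tight i = tight j"
  then show "i = j"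
    using essential_vanishing[of i j] by (auto simp: tight_def essential_def)
qed

text \<open>Every solution is the limit of its mixes with a fixed strict point, and these mixes are
  strict for small positive \<open>t\<close>.\<close>

lemma closure_strict_solutions: "closure {x \<in> H. \<forall>i\<in>I. 0 < f i x} = solutions"
proof
  have "closed {x. 0 \<le> f i x}" if "i \<in> I" for i
    using linear_as_inner[OF linear_f[OF that]] closed_halfspace_ge by metis
  then have "closed (H \<inter> (\<Inter>i\<in>I. {x. 0 \<le> f i x}))"
    by (intro closed_Int closed_INT affine_closed affine_H) auto
  moreover have "solutions = H \<inter> (\<Inter>i\<in>I. {x. 0 \<le> f i x})"
    by (auto simp: solutions_def)
  ultimately have "closed solutions" by simp
  then show "closure {x \<in> H. \<forall>i\<in>I. 0 < f i x} \<subseteq> solutions"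
    by (intro closure_minimal) (auto simp: solutions_def less_imp_le)
next
  obtain y where y: "y \<in> H" "\<And>i. i \<in> I \<Longrightarrow> 0 < f i y"
    using strictly_feasible by auto
  show "solutions \<subseteq> closure {x \<in> H. \<forall>i\<in>I. 0 < f i x}"
  proof
    fix x assume x: "x \<in> solutions"
    let ?g = "\<lambda>t. (1 - t) *\<^sub>R x + t *\<^sub>R y"
    have "(?g \<longlongrightarrow> (1 - 0) *\<^sub>R x + 0 *\<^sub>R y) (at_right (0::real))"
      by (intro tendsto_intros)
    then have lim: "(?g \<longlongrightarrow> x) (at_right (0::real))" by simp
    have "\<forall>\<^sub>F t in at_right 0. t < 1 \<and> (\<forall>i\<in>I. 0 < f i (?g t))"
      using x y by (intro eventually_mix_positive finite_I linear_f) (auto simp: solutions_def)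
    then have ev: "\<forall>\<^sub>F t in at_right 0. ?g t \<in> closure {x \<in> H. \<forall>i\<in>I. 0 < f i x}"
    proof eventually_elim
      case (elim t)
      moreover have "?g t \<in> H"
        using x y affine_H by (intro mem_affine) (auto simp: solutions_def)
      ultimately show ?case
        by (intro subsetD[OF closure_subset]) simp
    qed
    show "x \<in> closure {x \<in> H. \<forall>i\<in>I. 0 < f i x}"
      by (rule Lim_in_closed_set[OF closed_closure ev trivial_limit_at_right_real lim])
  qed
qed

end

subsection \<open>The inequalities of a game\<close>

definition weight_space :: "(real \<times> (real ^ 'n::finite)) set" where
  "weight_space = {(q, w). (\<Sum>i\<in>UNIV. w $ i) = 1}"

text \<open>For the least voter this is \<open>Max {}\<close>, which carries no meaning;
  \<open>gap\<close> compares that voter with 0 instead.\<close>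

definition predecessor :: "'n::{finite,linorder} \<Rightarrow> 'n" where
  "predecessor j = Max {i. i < j}"

definition gap :: "'n::{finite,linorder} \<Rightarrow> real ^ 'n::{finite,linorder} \<Rightarrow> real" where
  "gap j w = w $ j - (if j = Min UNIV then 0 else w $ predecessor j)"

text \<open>The index \<open>Inl A\<close> stands for the inequality of the coalition \<open>A\<close>, the index \<open>Inr j\<close> for the
  inequality of the simplex that bounds \<open>w\<^sub>j\<close> from below.\<close>

definition slack ::
    "'n::{finite,linorder} set set \<Rightarrow> 'n set + 'n \<Rightarrow> real \<times> (real ^ 'n::{finite,linorder}) \<Rightarrow> real" where
  "slack v i x = (case i of
     Inl A \<Rightarrow> if A \<in> v then weight (snd x) A - fst x else fst x - weight (snd x) A
   | Inr j \<Rightarrow> gap j (snd x))"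

text \<open>All conditions besides the total weight are open, so they survive small moves. The
  bounds on the quota are omitted: once \<open>UNIV\<close> wins and \<open>{}\<close> loses, these
  two coalitions force it between 0 and 1.\<close>

definition strict_realization ::
    "'n::{finite,linorder} set set \<Rightarrow> real \<times> (real ^ 'n::{finite,linorder}) \<Rightarrow> bool" where
  "strict_realization v x \<longleftrightarrow> x \<in> weight_space \<and> (\<forall>i. 0 < slack v i x)"

lemma mem_weight_space: "(q, w) \<in> weight_space \<longleftrightarrow> (\<Sum>i\<in>UNIV. w $ i) = 1"
  by (simp add: weight_space_def)

lemma slack_Inl:
  "slack v (Inl A) (q, w) = (if A \<in> v then weight w A - q else q - weight w A)"
  by (simp add: slack_def)

lemma slack_Inr [simp]: "slack v (Inr j) x = gap j (snd x)"
  by (simp add: slack_def)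

lemma slack_Inl_eq_0_iff: "slack v (Inl A) (q, w) = 0 \<longleftrightarrow> q = weight w A"
  by (auto simp: slack_Inl)

lemma all_slack_iff:
  "(\<forall>i. P (slack v i x)) \<longleftrightarrow> (\<forall>A. P (slack v (Inl A) x)) \<and> (\<forall>j. P (gap j (snd x)))"
  by (metis slack_Inr sum.exhaust)

lemma linear_weight: "linear (\<lambda>w. weight w A)"
  by (rule linearI) (auto simp: weight_def sum.distrib sum_distrib_left)

lemma linear_gap: "linear (gap j)"
  by (rule linearI) (auto simp: gap_def algebra_simps)

lemma linear_slack: "linear (slack v i)"
proof (cases i)
  case (Inl A)
  then show ?thesis
    by (intro linearI)
      (auto simp: slack_def linear_add[OF linear_weight] linear_scale[OF linear_weight] algebra_simps)
next
  case (Inr j)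
  then show ?thesis
    by (intro linearI) (auto simp: slack_def linear_add[OF linear_gap] linear_scale[OF linear_gap])
qed

lemma weight_empty [simp]: "weight w {} = 0"
  by (simp add: weight_def)

lemma weight_UNIV: "weight w UNIV = (\<Sum>i\<in>UNIV. w $ i)"
  by (simp add: weight_def)

lemma affine_unit_sum: "affine {w :: real ^ 'n::finite. (\<Sum>i\<in>UNIV. w $ i) = 1}"
  by (auto simp: affine_def sum.distrib sum_distrib_left[symmetric])

lemma affine_weight_space: "affine (weight_space :: (real \<times> (real ^ 'n::finite)) set)"
  by (auto simp: weight_space_def affine_def sum.distrib sum_distrib_left[symmetric])

section \<open>Gaps between consecutive voters and the weight simplex\<close>

lemma Min_UNIV_le [simp]: "Min UNIV \<le> (j :: 'n::{finite,linorder})"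
  by simp

lemma predecessor:
  fixes j :: "'n::{finite,linorder}"
  assumes "j \<noteq> Min UNIV"
  shows predecessor_less: "predecessor j < j"
    and predecessor_ge: "i < j \<Longrightarrow> i \<le> predecessor j"
proof -
  have "Min UNIV < j"
    using assms Min_UNIV_le[of j] by (simp add: order_less_le)
  then have "predecessor j \<in> {i. i < j}"
    unfolding predecessor_def by (intro Max_in) auto
  then show "predecessor j < j" by simp
  show "i < j \<Longrightarrow> i \<le> predecessor j"
    unfolding predecessor_def by (intro Max_ge) auto
qed

lemma consecutive_iff:
  "consecutive i j \<longleftrightarrow> j \<noteq> Min UNIV \<and> i = predecessor (j :: 'n::{finite,linorder})"
proof
  assume c: "consecutive i j"
  then have "j \<noteq> Min UNIV"
    using Min_UNIV_le[of i] by (auto simp: consecutive_def)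
  with c show "j \<noteq> Min UNIV \<and> i = predecessor j"
    using predecessor[of j] by (auto simp: consecutive_def order_le_less)
next
  assume "j \<noteq> Min UNIV \<and> i = predecessor j"
  then show "consecutive i j"
    using predecessor[of j] by (fastforce simp: consecutive_def)
qed

lemma monotone_of_gap_nonneg:
  fixes w :: "real ^ 'n::{finite,linorder}"
  assumes "\<And>j. 0 \<le> gap j w" "i \<le> j"
  shows "w $ i \<le> w $ j"
  using assms(2)
\<comment> \<open>The number of smaller voters drops in passing from \<open>j\<close> to its
  predecessor.\<close>
proof (induction "card {l. l < j}" arbitrary: j rule: less_induct)
  case less
  show ?case
  proof (cases "i = j")
    case False
    with less.prems have "i < j" by simp
    then have j: "j \<noteq> Min UNIV"
      using Min_UNIV_le[of i] by auto
    have "{l. l < predecessor j} \<subset> {l. l < j}"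
      using predecessor_less[OF j] by auto
    then have "w $ i \<le> w $ predecessor j"
      using predecessor_ge[OF j \<open>i < j\<close>] by (intro less.hyps psubset_card_mono) auto
    with assms(1)[of j] j show ?thesis
      by (simp add: gap_def)
  qed simp
qed

lemma nonneg_of_gap_nonneg:
  fixes w :: "real ^ 'n::{finite,linorder}"
  assumes "\<And>j. 0 \<le> gap j w"
  shows "0 \<le> w $ i"
proof -
  have "0 \<le> w $ Min UNIV"
    using assms[of "Min UNIV"] by (simp add: gap_def)
  with monotone_of_gap_nonneg[of w "Min UNIV" i] assms show ?thesis
    by simp
qed

lemma weight_simplex_eq:
  "weight_simplex = {w. (\<Sum>i\<in>UNIV. w $ i) = 1 \<and> (\<forall>j::'n::{finite,linorder}. 0 \<le> gap j w)}"
proof (intro set_eqI iffI)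
  fix w :: "real ^ 'n::{finite,linorder}" assume "w \<in> weight_simplex"
  then show "w \<in> {w. (\<Sum>i\<in>UNIV. w $ i) = 1 \<and> (\<forall>j. 0 \<le> gap j w)}"
    by (auto simp: weight_simplex_def gap_def predecessor_less less_imp_le)
next
  fix w :: "real ^ 'n::{finite,linorder}" assume "w \<in> {w. (\<Sum>i\<in>UNIV. w $ i) = 1 \<and> (\<forall>j. 0 \<le> gap j w)}"
  then show "w \<in> weight_simplex"
    by (auto simp: weight_simplex_def monotone_of_gap_nonneg nonneg_of_gap_nonneg)
qed

text \<open>The vertices of the weight simplex, and barycentres of sets of vertices.\<close>

definition staircase :: "'n::{finite,linorder} \<Rightarrow> real ^ 'n::{finite,linorder}" where
  "staircase m = (\<chi> i. if m \<le> i then 1 / card {m..} else 0)"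

definition ramp :: "'n::{finite,linorder} set \<Rightarrow> real ^ 'n::{finite,linorder}" where
  "ramp M = (1 / card M) *\<^sub>R (\<Sum>m\<in>M. staircase m)"

lemma card_atLeast_pos: "0 < card {m :: 'n::{finite,linorder}..}"
  by (auto simp: card_gt_0_iff)

lemma gap_staircase:
  "gap j (staircase m) = (if j = m then 1 / card {m..} else 0)"
proof (cases "j = Min UNIV")
  case True
  have "m \<le> Min UNIV \<longleftrightarrow> Min UNIV = m"
    using Min_UNIV_le[of m] by (metis order_antisym order_refl)
  with True show ?thesis
    by (simp add: gap_def staircase_def del: Min_ge_iff)
next
  case False
  note p = predecessor[OF False]
  have "m \<le> predecessor j \<longleftrightarrow> m \<le> j \<and> j \<noteq> m"
    using p by (metis leD order.strict_trans2 order_less_le)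
  with False show ?thesis
    by (auto simp: gap_def staircase_def)
qed

lemma sum_staircase: "(\<Sum>i\<in>UNIV. staircase (m :: 'n::{finite,linorder}) $ i) = 1"
proof -
  have "(\<Sum>i\<in>UNIV. staircase m $ i) = (\<Sum>i\<in>{m..}. 1 / card {m..})"
    by (simp add: staircase_def sum.If_cases atLeast_def)
  then show ?thesis
    using card_atLeast_pos[of m] by simp
qed

lemma gap_ramp: "gap j (ramp M) = (if j \<in> M then 1 / (card M * card {j..}) else 0)"
  by (simp add: ramp_def linear_scale[OF linear_gap] linear_sum[OF linear_gap] gap_staircase
      sum.delta' finite_subset[OF subset_UNIV])

text \<open>The choice of \<open>M\<close> prescribes which simplex inequalities are tight:
  \<open>ramp UNIV\<close> is strict in all of them, and \<open>ramp {j}\<close> is the vertex where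
  only that of \<open>j\<close> is strict.\<close>

lemma gap_ramp_pos_iff: "0 < gap j (ramp M) \<longleftrightarrow> j \<in> M"
proof -
  have "0 < card M" if "j \<in> M"
    using that by (auto simp: card_gt_0_iff)
  then show ?thesis
    using card_atLeast_pos[of j] by (auto simp: gap_ramp)
qed

lemma gap_ramp_eq_0_iff: "gap j (ramp M) = 0 \<longleftrightarrow> j \<notin> M"
  using gap_ramp_pos_iff[of j M] gap_ramp[of j M] by (auto split: if_splits)

lemma sum_ramp:
  assumes "M \<noteq> {}"
  shows "(\<Sum>i\<in>UNIV. ramp (M :: 'n::{finite,linorder} set) $ i) = 1"
proof -
  have "(\<Sum>i\<in>UNIV. ramp M $ i) = weight (ramp M) UNIV"
    by (simp add: weight_UNIV)
  also have "\<dots> = (1 / card M) * (\<Sum>m\<in>M. weight (staircase m) UNIV)"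
    by (simp add: ramp_def linear_scale[OF linear_weight] linear_sum[OF linear_weight])
  also have "\<dots> = 1"
    using assms by (simp add: weight_UNIV sum_staircase card_gt_0_iff)
  finally show ?thesis .
qed

text \<open>Vertical facets are defined through facets of the simplex, so the facet theorem is
  applied to the simplex as well.\<close>

interpretation simplex: linear_system
  "{w :: real ^ 'n::{finite,linorder}. (\<Sum>i\<in>UNIV. w $ i) = 1}" UNIV gap
proof (rule linear_system.intro)
  show "\<exists>w\<in>{w :: real ^ 'n::{finite,linorder}. (\<Sum>i\<in>UNIV. w $ i) = 1}. \<forall>j\<in>UNIV. 0 < gap j w"
    by (rule bexI[of _ "ramp UNIV"]) (auto simp: gap_ramp_pos_iff sum_ramp)
  fix i j :: 'n assume "i \<noteq> j"
  then show "\<exists>w\<in>{w. (\<Sum>i\<in>UNIV. w $ i) = 1}. gap i w = 0 \<and> gap j w \<noteq> 0"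
    by (intro bexI[of _ "ramp {j}"]) (auto simp: gap_ramp_eq_0_iff sum_ramp)
qed (simp_all add: affine_unit_sum linear_gap)

lemma simplex_solutions: "simplex.solutions = weight_simplex"
  by (simp add: simplex.solutions_def weight_simplex_eq)

lemma simplex_tight:
  "simplex.tight j =
    (if j = Min UNIV then zero_weight_face else equal_weights_face (predecessor j) j)"
  by (auto simp: simplex.tight_def simplex_solutions zero_weight_face_def equal_weights_face_def
      gap_def)

section \<open>Realizations and strict realizations\<close>

lemma realizations_iff:
  fixes v :: "'n::{finite,linorder} set set"
  assumes "UNIV \<in> v" "{} \<notin> v"
  shows "x \<in> realizations v \<longleftrightarrow>
    x \<in> weight_space \<and> (\<forall>i. 0 \<le> slack v i x) \<and> (\<forall>A. A \<notin> v \<longrightarrow> 0 < slack v (Inl A) x)"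
    (is "_ \<longleftrightarrow> ?R")
proof -
  obtain q w where x: "x = (q, w)" by (cases x)
  show ?thesis
  proof
    assume "x \<in> realizations v"
    then show ?R
      by (auto simp: x realizations_def config_space_def weight_simplex_eq weight_space_def
          all_slack_iff[of "\<lambda>t. 0 \<le> t"] slack_Inl not_le less_imp_le)
  next
    assume R: ?R
    then have w: "w \<in> weight_simplex" and
      A: "\<And>A. A \<in> v \<Longrightarrow> q \<le> weight w A" "\<And>A. A \<notin> v \<Longrightarrow> weight w A < q"
      by (auto simp: x weight_simplex_eq weight_space_def all_slack_iff[of "\<lambda>t. 0 \<le> t"] slack_Inl
          split: if_splits)
    \<comment> \<open>The losing empty coalition has weight 0 and the winning grand coalition has
      weight 1.\<close>
    have "0 < q" "q \<le> 1"
      using A(1)[OF assms(1)] A(2)[OF assms(2)] w by (auto simp: weight_UNIV weight_simplex_eq)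
    then show "x \<in> realizations v"
      using w A by (force simp: x realizations_def config_space_def)
  qed
qed

lemma weight_mono:
  assumes "\<And>i. 0 \<le> w $ i" "A \<subseteq> B"
  shows "weight w A \<le> weight w B"
  unfolding weight_def using assms by (intro sum_mono2) auto

lemma strict_realization_nonneg:
  assumes "strict_realization v (q, w)"
  shows "0 \<le> w $ i"
  using assms by (intro nonneg_of_gap_nonneg)
    (auto simp: strict_realization_def all_slack_iff[of "\<lambda>t. 0 < t"] less_imp_le)

lemma strict_realization_iff:
  "strict_realization v (q, w) \<longleftrightarrow> (\<Sum>i\<in>UNIV. w $ i) = 1 \<and> (\<forall>j. 0 < gap j w) \<and>
    (\<forall>A. (A \<in> v \<longrightarrow> q < weight w A) \<and> (A \<notin> v \<longrightarrow> weight w A < q))"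
  by (auto simp: strict_realization_def weight_space_def all_slack_iff[of "\<lambda>t. 0 < t"] slack_Inl)

text \<open>A realization may have winning coalitions exactly at the quota and ties between weights.
  Lowering the quota slightly and spreading the weights removes both, without harm to the losing
  coalitions, which are strictly below the quota already.\<close>

lemma weighted_iff_strict:
  fixes v :: "'n::{finite,linorder} set set"
  shows "weighted v \<longleftrightarrow> UNIV \<in> v \<and> {} \<notin> v \<and> (\<exists>x. strict_realization v x)" (is "_ \<longleftrightarrow> ?R")
proof
  assume "weighted v"
  then obtain x where v: "UNIV \<in> v" "{} \<notin> v" and "x \<in> realizations v"
    by (auto simp: weighted_def simple_game_def)
  then have x: "x \<in> weight_space" "\<And>i. 0 \<le> slack v i x"
      "\<And>A. A \<notin> v \<Longrightarrow> 0 < slack v (Inl A) x"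
    by (auto simp: realizations_iff)
  \<comment> \<open>A quota of -1 lies below every weight, and \<open>ramp UNIV\<close> has positive
    gaps. Thus \<open>y\<close> is strict in every inequality that may be tight at \<open>x\<close>;
    it violates only those of losing coalitions.\<close>
  define y :: "real \<times> (real ^ 'n::{finite,linorder})" where "y = (-1, ramp UNIV)"
  have y: "0 < slack v (Inr j) y" for j
    by (simp add: y_def gap_ramp_pos_iff)
  have "0 \<le> weight (ramp UNIV) A" for A :: "'n set"
    unfolding weight_def
    by (intro sum_nonneg nonneg_of_gap_nonneg) (simp add: gap_ramp_pos_iff less_imp_le)
  then have y': "0 < slack v (Inl A) y" if "A \<in> v" for A
    using that by (simp add: y_def slack_Inl add_nonneg_pos)
  have "0 < slack v i x \<or> (0 \<le> slack v i x \<and> 0 < slack v i y)" for i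
  proof (cases i)
    case (Inl A)
    with x y' show ?thesis by (cases "A \<in> v") auto
  next
    case (Inr j)
    with x(2)[of i] y[of j] show ?thesis by simp
  qed
  then obtain t where "\<And>i. 0 < slack v i ((1 - t) *\<^sub>R x + t *\<^sub>R y)"
    using mix_positive[of UNIV "slack v" x y, OF finite linear_slack] by auto
  moreover have "(1 - t) *\<^sub>R x + t *\<^sub>R y \<in> weight_space"
    using x by (intro mem_affine affine_weight_space) (auto simp: y_def weight_space_def sum_ramp)
  ultimately show ?R
    using v unfolding strict_realization_def by blast
next
  assume ?R
  then obtain q w where v: "UNIV \<in> v" "{} \<notin> v" and s: "strict_realization v (q, w)"
    by auto
  then have "(q, w) \<in> realizations v"
    by (auto simp: realizations_iff strict_realization_def less_imp_le)
  \<comment> \<open>Closure under supersets is forced by nonnegative weights.\<close>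
  moreover have "B \<in> v" if "A \<in> v" "A \<subseteq> B" for A B
  proof (rule ccontr)
    assume "B \<notin> v"
    with s that have "weight w B < weight w A"
      by (meson strict_realization_iff order_less_trans)
    moreover have "weight w A \<le> weight w B"
      using strict_realization_nonneg[OF s] that(2) by (rule weight_mono)
    ultimately show False by simp
  qed
  ultimately show "weighted v"
    using v by (auto simp: weighted_def simple_game_def)
qed

lemma weight_axis: "weight (axis e 1) A = (if e \<in> A then 1 else 0)"
  by (simp add: weight_def axis_def)

lemma increasing_of_gap_pos:
  fixes w :: "real ^ 'n::{finite,linorder}"
  assumes "\<And>j. 0 \<le> gap j w" "0 < gap j w" "i < j"
  shows "w $ i < w $ j"
proof -
  have j: "j \<noteq> Min UNIV"
    using assms(3) Min_UNIV_le[of i] by auto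
  have "w $ i \<le> w $ predecessor j"
    using assms(1) predecessor_ge[OF j assms(3)] by (rule monotone_of_gap_nonneg)
  also have "\<dots> < w $ j"
    using assms(2) j by (simp add: gap_def)
  finally show ?thesis .
qed

lemma pos_of_gap_pos:
  fixes w :: "real ^ 'n::{finite,linorder}"
  assumes "\<And>j. 0 < gap j w"
  shows "0 < w $ i"
proof -
  have "w $ Min UNIV \<le> w $ i"
    using assms by (intro monotone_of_gap_nonneg) (auto simp: less_imp_le)
  moreover have "0 < w $ Min UNIV"
    using assms[of "Min UNIV"] by (simp add: gap_def)
  ultimately show ?thesis by simp
qed

section \<open>Weights and the shift order\<close>

lemma weight_as_descending_sum:
  "weight w A = (\<Sum>i<card A. w $ (descending A ! i))"
proof -
  have "weight w A = sum_list (map (($) w) (descending A))"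
    using sum.distinct_set_conv_list[of "descending A" "($) w"]
    by (simp add: weight_def descending_def)
  also have "\<dots> = (\<Sum>i<card A. w $ (descending A ! i))"
    by (simp add: sum_list_sum_nth descending_def atLeast0LessThan)
  finally show ?thesis .
qed

text \<open>Listed in descending order, the members of \<open>A\<close> are dominated one by one by
  the first members of \<open>B\<close>; the remaining members of \<open>B\<close> add nonnegative
  weight.\<close>

lemma shift_le_weight:
  assumes "shift_le A B" "\<And>j. 0 \<le> gap j w"
  shows "weight w A \<le> weight w B"
proof -
  have "weight w A \<le> (\<Sum>i<card A. w $ (descending B ! i))"
    unfolding weight_as_descending_sum[of w A] using assms
    by (intro sum_mono monotone_of_gap_nonneg) (auto simp: shift_le_def)
  also have "\<dots> \<le> weight w B"
    unfolding weight_as_descending_sum[of w B] using assms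
    by (intro sum_mono2 nonneg_of_gap_nonneg) (auto simp: shift_le_def)
  finally show ?thesis .
qed

text \<open>One toggle handles both directions of the covering relation: on the slacks it only
  reverses the sign belonging to \<open>A\<close>.\<close>

definition flip :: "'a \<Rightarrow> 'a set \<Rightarrow> 'a set" where
  "flip A v = (if A \<in> v then v - {A} else insert A v)"

lemma mem_flip_iff: "B \<in> flip A v \<longleftrightarrow> (if B = A then A \<notin> v else B \<in> v)"
  by (auto simp: flip_def)

lemma slack_flip: "slack (flip A v) i x = (if i = Inl A then - slack v i x else slack v i x)"
  by (auto simp: slack_def mem_flip_iff split: sum.split)

section \<open>The polytope of a weighted game\<close>

locale weighted_game =
  fixes v :: "'n::{finite,linorder} set set"
  assumes weighted: "weighted v"
begin

lemma UNIV_winning: "UNIV \<in> v" and empty_losing: "{} \<notin> v"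
  using weighted by (auto simp: weighted_def simple_game_def)

lemma winning_mono: "A \<in> v \<Longrightarrow> A \<subseteq> B \<Longrightarrow> B \<in> v"
  using weighted by (auto simp: weighted_def simple_game_def)

lemma strict_point: obtains q w where "strict_realization v (q, w)"
  using weighted unfolding weighted_iff_strict by auto

sublocale linear_system weight_space UNIV "slack v"
proof (rule linear_system.intro)
  show "\<exists>x\<in>weight_space. \<forall>i\<in>UNIV. 0 < slack v i x"
    using weighted unfolding weighted_iff_strict strict_realization_def by auto
  fix i j :: "'n set + 'n"
  assume "i \<noteq> j" and ex: "\<exists>x\<in>weight_space. slack v i x = 0"
  \<comment> \<open>Witnesses need only have total weight 1; their weights may be unordered and
    their quota arbitrary.\<close>
  have witness: "\<exists>x\<in>weight_space. slack v i x = 0 \<and> slack v j x \<noteq> 0"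
    if "(\<Sum>i\<in>UNIV. w $ i) = 1" "slack v i (q, w) = 0" "slack v j (q, w) \<noteq> 0" for q w
    using that by (intro bexI[of _ "(q, w)"]) (auto simp: mem_weight_space)
  show "\<exists>x\<in>weight_space. slack v i x = 0 \<and> slack v j x \<noteq> 0"
  proof (cases i; cases j)
    \<comment> \<open>All weight is put on a voter \<open>e\<close> of exactly one of the two
      coalitions, so their weights are 0 and 1.\<close>
    fix A B assume ij: "i = Inl A" "j = Inl B"
    with \<open>i \<noteq> j\<close> obtain e where "e \<in> A \<longleftrightarrow> e \<notin> B" by auto
    with ij show ?thesis
      by (intro witness[of "axis e 1" "weight (axis e 1) A"])
        (auto simp: slack_Inl_eq_0_iff weight_axis weight_UNIV[symmetric])
  next
    fix A l assume "i = Inl A" "j = Inr l"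
    then show ?thesis
      by (intro witness[of "ramp {l}" "weight (ramp {l}) A"])
        (auto simp: slack_Inl_eq_0_iff sum_ramp gap_ramp_eq_0_iff)
  next
    \<comment> \<open>A simplex inequality does not involve the quota, which can therefore be moved
      off the hyperplane of \<open>B\<close>.\<close>
    fix l B assume ij: "i = Inr l" "j = Inl B"
    with ex obtain q w where "(\<Sum>i\<in>UNIV. w $ i) = 1" "gap l w = 0"
      by (auto simp: mem_weight_space)
    with ij show ?thesis
      by (intro witness[of w "weight w B + 1"]) (auto simp: slack_Inl_eq_0_iff)
  next
    fix l m assume "i = Inr l" "j = Inr m"
    with \<open>i \<noteq> j\<close> show ?thesis
      by (intro witness[of "ramp {m}" 0]) (auto simp: sum_ramp gap_ramp_eq_0_iff)
  qed
qed (simp_all add: affine_weight_space linear_slack)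

text \<open>The realizations lie between the strict solutions and the weak ones, and the closure of
  the former is the latter.\<close>

lemma closure_realizations: "closure (realizations v) = solutions"
proof
  let ?S = "{x \<in> weight_space. \<forall>i\<in>UNIV. 0 < slack v i x}"
  note iff = realizations_iff[OF UNIV_winning empty_losing]
  have "?S \<subseteq> realizations v"
    by (auto simp: iff less_imp_le)
  then show "solutions \<subseteq> closure (realizations v)"
    unfolding closure_strict_solutions[symmetric] by (rule closure_mono)
  have "realizations v \<subseteq> solutions"
    by (auto simp: iff solutions_def)
  moreover have "closed solutions"
    unfolding closure_strict_solutions[symmetric] by (rule closed_closure)
  ultimately show "closure (realizations v) \<subseteq> solutions"
    by (rule closure_minimal)
qed

lemma facets_eq: "facets v = tight ` essential"
  by (auto simp: facets_def closure_realizations facet_of_solutions_iff)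

lemma tight_Inl_subset: "tight (Inl A) \<subseteq> coalition_hyperplane A"
  by (auto simp: tight_def solutions_def coalition_hyperplane_def mem_weight_space
      slack_Inl_eq_0_iff)

text \<open>On a facet inside the hyperplane of \<open>A\<close> the slack of \<open>A\<close>
  vanishes, and \<open>essential_vanishing\<close> leaves only the index \<open>Inl A\<close>. So
  top and bottom facets, defined by containment, can be indexed by coalitions.\<close>

lemma facet_in_coalition_hyperplane_iff:
  "F \<in> facets v \<and> F \<subseteq> coalition_hyperplane A \<longleftrightarrow> Inl A \<in> essential \<and> F = tight (Inl A)"
proof
  assume F: "F \<in> facets v \<and> F \<subseteq> coalition_hyperplane A"
  then obtain i where i: "i \<in> essential" "F = tight i"
    by (auto simp: facets_eq)
  then have "slack v (Inl A) x = 0" if "x \<in> tight i" for x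
    using F that by (cases x) (auto simp: coalition_hyperplane_def slack_Inl_eq_0_iff)
  from essential_vanishing[OF i(1) UNIV_I this] i
  show "Inl A \<in> essential \<and> F = tight (Inl A)" by auto
qed (auto simp: facets_eq tight_Inl_subset)

lemma top_facets_eq: "top_facets v = (\<lambda>A. tight (Inl A)) ` {A \<in> v. Inl A \<in> essential}"
proof -
  have "top_facets v = {F. \<exists>A\<in>v. F \<in> facets v \<and> F \<subseteq> coalition_hyperplane A}"
    by (auto simp: top_facets_def)
  then show ?thesis
    unfolding facet_in_coalition_hyperplane_iff by auto
qed

lemma bottom_facets_eq: "bottom_facets v = (\<lambda>A. tight (Inl A)) ` {A. A \<notin> v \<and> Inl A \<in> essential}"
proof -
  have "bottom_facets v = {F. \<exists>A. A \<notin> v \<and> F \<in> facets v \<and> F \<subseteq> coalition_hyperplane A}"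
    by (auto simp: bottom_facets_def)
  then show ?thesis
    unfolding facet_in_coalition_hyperplane_iff by auto
qed

text \<open>Tightness fixes the quota at the weight of \<open>A\<close>, which eliminates it:
  \<open>A\<close> sits strictly between all other winning and all other losing coalitions.\<close>

lemma essential_Inl_point:
  assumes "Inl A \<in> essential"
  obtains w where "(\<Sum>i\<in>UNIV. w $ i) = 1" "\<And>j. 0 < gap j w"
    "\<And>B. \<lbrakk>B \<in> v; B \<noteq> A\<rbrakk> \<Longrightarrow> weight w A < weight w B"
    "\<And>B. \<lbrakk>B \<notin> v; B \<noteq> A\<rbrakk> \<Longrightarrow> weight w B < weight w A"
proof -
  obtain q w where x: "(q, w) \<in> weight_space" "slack v (Inl A) (q, w) = 0"
    and pos: "\<And>i. i \<noteq> Inl A \<Longrightarrow> 0 < slack v i (q, w)"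
    using assms by (auto simp: essential_def)
  have "0 < gap j w" for j
    using pos[of "Inr j"] by simp
  moreover have "weight w A < weight w B" if "B \<in> v" "B \<noteq> A" for B
    using pos[of "Inl B"] that x(2) by (simp add: slack_Inl_eq_0_iff) (simp add: slack_Inl)
  moreover have "weight w B < weight w A" if "B \<notin> v" "B \<noteq> A" for B
    using pos[of "Inl B"] that x(2) by (simp add: slack_Inl_eq_0_iff) (simp add: slack_Inl)
  ultimately show ?thesis
    using that[of w] x(1) by (simp add: mem_weight_space)
qed

lemma essential_InlI:
  assumes "(\<Sum>i\<in>UNIV. w $ i) = 1" "\<And>j. 0 < gap j w"
    "\<And>B. \<lbrakk>B \<in> v; B \<noteq> A\<rbrakk> \<Longrightarrow> weight w A < weight w B"
    "\<And>B. \<lbrakk>B \<notin> v; B \<noteq> A\<rbrakk> \<Longrightarrow> weight w B < weight w A"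
  shows "Inl A \<in> essential"
proof -
  have "0 < slack v i (weight w A, w)" if "i \<noteq> Inl A" for i
    using that assms(2-4) by (cases i) (auto simp: slack_Inl)
  with assms(1) show ?thesis
    by (auto simp: essential_def mem_weight_space slack_Inl_eq_0_iff
        intro!: bexI[of _ "(weight w A, w)"])
qed

text \<open>No coalition outweighs \<open>UNIV\<close>, so being lighter than every other winning
  coalition leaves it no rival. Conversely, positive weights make every other coalition strictly
  lighter.\<close>

lemma essential_UNIV_iff: "Inl UNIV \<in> essential \<longleftrightarrow> v = unanimity_game"
proof
  assume "Inl UNIV \<in> essential"
  then obtain w where w: "\<And>j. 0 < gap j w"
    "\<And>B. \<lbrakk>B \<in> v; B \<noteq> UNIV\<rbrakk> \<Longrightarrow> weight w UNIV < weight w B"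
    using essential_Inl_point by metis
  have "weight w B \<le> weight w UNIV" for B
    using pos_of_gap_pos[OF w(1)] by (intro weight_mono) (auto simp: less_imp_le)
  with w(2) have "B = UNIV" if "B \<in> v" for B
    using that leD by blast
  with UNIV_winning show "v = unanimity_game"
    by (auto simp: unanimity_game_def)
next
  assume v: "v = unanimity_game"
  have "weight (ramp UNIV) B < weight (ramp UNIV) (UNIV :: 'n set)" if B: "B \<noteq> UNIV" for B :: "'n set"
  proof -
    have pos: "0 < ramp UNIV $ i" for i :: 'n
      by (rule pos_of_gap_pos) (simp add: gap_ramp_pos_iff)
    obtain b where "b \<notin> B"
      using B by auto
    then show ?thesis
      using sum_strict_mono2[of UNIV B b "($) (ramp UNIV)"] pos less_imp_le[OF pos]
      by (simp add: weight_def)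
  qed
  then show "Inl UNIV \<in> essential"
    by (intro essential_InlI[of "ramp UNIV"]) (auto simp: v unanimity_game_def sum_ramp gap_ramp_pos_iff)
qed

text \<open>Dually, no coalition is lighter than the empty one.\<close>

lemma essential_empty_iff: "Inl {} \<in> essential \<longleftrightarrow> v = any_voter_game"
proof
  assume "Inl {} \<in> essential"
  then obtain w where w: "\<And>j. 0 < gap j w"
    "\<And>B. \<lbrakk>B \<notin> v; B \<noteq> {}\<rbrakk> \<Longrightarrow> weight w B < weight w {}"
    using essential_Inl_point by metis
  have "weight w {} \<le> weight w B" for B
    using pos_of_gap_pos[OF w(1)] by (intro weight_mono) (auto simp: less_imp_le)
  with w(2) have "B = {}" if "B \<notin> v" for B
    using that leD by blast
  with empty_losing show "v = any_voter_game"
    by (auto simp: any_voter_game_def)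
next
  assume v: "v = any_voter_game"
  have "0 < weight (ramp UNIV) B" if "B \<noteq> {}" for B :: "'n set"
    unfolding weight_def using that
    by (intro sum_pos) (auto intro: pos_of_gap_pos simp: gap_ramp_pos_iff)
  then show "Inl {} \<in> essential"
    by (intro essential_InlI[of "ramp UNIV"]) (auto simp: v any_voter_game_def sum_ramp gap_ramp_pos_iff)
qed

text \<open>The two excluded coalitions may give facets, but changing their status never yields a
  simple game.\<close>

lemma essential_iff_weighted_flip:
  assumes "A \<noteq> UNIV" "A \<noteq> {}"
  shows "Inl A \<in> essential \<longleftrightarrow> weighted (flip A v)"
proof
  assume "Inl A \<in> essential"
  then obtain x where x: "x \<in> weight_space" "slack v (Inl A) x = 0"
    and pos: "\<And>i. i \<noteq> Inl A \<Longrightarrow> 0 < slack v i x"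
    by (auto simp: essential_def)
  let ?w = "ramp UNIV :: real ^ 'n::{finite,linorder}"
  \<comment> \<open>The point \<open>y\<close> lies beyond the hyperplane of \<open>A\<close>, where
    the slack of \<open>A\<close> is -1. The other inequalities are strict at \<open>x\<close> and
    survive a short step towards \<open>y\<close>.\<close>
  define y where "y = (if A \<in> v then weight ?w A + 1 else weight ?w A - 1, ?w)"
  have "slack v (Inl A) y < 0"
    by (simp add: y_def slack_Inl)
  with x pos have "0 < slack (flip A v) i x \<or> 0 \<le> slack (flip A v) i x \<and> 0 < slack (flip A v) i y" for i
    by (cases "i = Inl A") (auto simp: slack_flip)
  then obtain t where "\<And>i. 0 < slack (flip A v) i ((1 - t) *\<^sub>R x + t *\<^sub>R y)"
    using mix_positive[of UNIV "slack (flip A v)" x y, OF finite linear_slack] by auto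
  moreover have "(1 - t) *\<^sub>R x + t *\<^sub>R y \<in> weight_space"
    using x by (intro mem_affine affine_weight_space) (auto simp: y_def mem_weight_space sum_ramp)
  ultimately have "\<exists>x. strict_realization (flip A v) x"
    unfolding strict_realization_def by blast
  with assms UNIV_winning empty_losing show "weighted (flip A v)"
    by (auto simp: weighted_iff_strict mem_flip_iff)
next
  assume "weighted (flip A v)"
  then obtain y where y: "y \<in> weight_space" "\<And>i. 0 < slack (flip A v) i y"
    by (auto simp: weighted_iff_strict strict_realization_def)
  obtain x where x: "x \<in> weight_space" "\<And>i. 0 < slack v i x"
    using weighted by (auto simp: weighted_iff_strict strict_realization_def)
  define a b where "a = slack v (Inl A) x" and "b = - slack v (Inl A) y"
  have "0 < a" "0 < b"
    using x(2)[of "Inl A"] y(2)[of "Inl A"] by (auto simp: a_def b_def slack_flip)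
  \<comment> \<open>Along the segment the slack of \<open>A\<close> falls linearly from
    \<open>a\<close> to \<open>- b\<close>, and it vanishes at this parameter.\<close>
  define t where "t = a / (a + b)"
  have t: "0 < t" "t < 1"
    using \<open>0 < a\<close> \<open>0 < b\<close> by (auto simp: t_def)
  let ?z = "(1 - t) *\<^sub>R x + t *\<^sub>R y"
  have z: "slack v i ?z = (1 - t) * slack v i x + t * slack v i y" for i
    by (simp add: linear_add[OF linear_slack] linear_scale[OF linear_slack])
  have "slack v (Inl A) ?z = (1 - t) * a - t * b"
    by (simp add: z a_def b_def)
  also have "\<dots> = 0"
    using \<open>0 < a\<close> \<open>0 < b\<close> by (simp add: t_def field_simps)
  finally have "slack v (Inl A) ?z = 0" .
  moreover have "0 < slack v i ?z" if "i \<noteq> Inl A" for i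
    using that x(2)[of i] y(2)[of i] t by (simp add: z slack_flip add_pos_pos)
  moreover have "?z \<in> weight_space"
    using x y by (intro mem_affine affine_weight_space) auto
  ultimately show "Inl A \<in> essential"
    by (auto simp: essential_def)
qed

section \<open>Neighbours in the Hasse diagram\<close>

lemma covers_iff:
  "covers u v \<longleftrightarrow> (\<exists>A\<in>v. A \<noteq> UNIV \<and> Inl A \<in> essential \<and> u = v - {A})"
proof
  assume "covers u v"
  then obtain A where A: "weighted u" "A \<notin> u" "v = u \<union> {A}"
    by (auto simp: covers_def)
  then have "A \<in> v" "u = v - {A}" by auto
  moreover from this have "u = flip A v"
    by (simp add: flip_def)
  moreover have "A \<noteq> UNIV"
    using A by (auto simp: weighted_iff_strict)
  moreover have "A \<noteq> {}"
    using \<open>A \<in> v\<close> empty_losing by auto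
  ultimately show "\<exists>A\<in>v. A \<noteq> UNIV \<and> Inl A \<in> essential \<and> u = v - {A}"
    using A(1) essential_iff_weighted_flip[of A] by auto
next
  assume "\<exists>A\<in>v. A \<noteq> UNIV \<and> Inl A \<in> essential \<and> u = v - {A}"
  then obtain A where A: "A \<in> v" "A \<noteq> UNIV" "Inl A \<in> essential" "u = flip A v" "u = v - {A}"
    by (auto simp: flip_def)
  moreover have "A \<noteq> {}"
    using A empty_losing by auto
  ultimately show "covers u v"
    using essential_iff_weighted_flip[of A] weighted by (auto simp: covers_def)
qed

lemma covered_iff:
  "covers v g \<longleftrightarrow> (\<exists>B. B \<notin> v \<and> B \<noteq> {} \<and> Inl B \<in> essential \<and> g = insert B v)"
proof
  assume "covers v g"
  then obtain B where B: "weighted g" "B \<notin> v" "g = insert B v"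
    by (auto simp: covers_def)
  then have "g = flip B v" "B \<noteq> UNIV" "B \<noteq> {}"
    using UNIV_winning by (auto simp: flip_def weighted_iff_strict)
  with B show "\<exists>B. B \<notin> v \<and> B \<noteq> {} \<and> Inl B \<in> essential \<and> g = insert B v"
    using essential_iff_weighted_flip[of B] by auto
next
  assume "\<exists>B. B \<notin> v \<and> B \<noteq> {} \<and> Inl B \<in> essential \<and> g = insert B v"
  then obtain B where B: "B \<notin> v" "B \<noteq> {}" "Inl B \<in> essential" "g = flip B v" "g = insert B v"
    by (auto simp: flip_def)
  moreover have "B \<noteq> UNIV"
    using B UNIV_winning by auto
  ultimately show "covers v g"
    using essential_iff_weighted_flip[of B] weighted by (auto simp: covers_def)
qed

text \<open>At an essential point \<open>A\<close> is the unique lightest winning coalition, while a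
  coalition below it in the shift order weighs no more.\<close>

lemma essential_shift_minimal:
  assumes "A \<in> v" "Inl A \<in> essential"
  shows "shift_minimal_winning v A"
  unfolding shift_minimal_winning_def
proof (intro conjI assms allI impI)
  fix C assume C: "C \<in> v \<and> shift_le C A"
  obtain w where w: "\<And>j. 0 < gap j w" "\<And>B. \<lbrakk>B \<in> v; B \<noteq> A\<rbrakk> \<Longrightarrow> weight w A < weight w B"
    using essential_Inl_point[OF assms(2)] by metis
  have "weight w C \<le> weight w A"
    using C w by (intro shift_le_weight) (auto simp: less_imp_le)
  then show "C = A"
    using w(2)[of C] C by force
qed

lemma essential_shift_maximal:
  assumes "B \<notin> v" "Inl B \<in> essential"
  shows "shift_maximal_losing v B"
  unfolding shift_maximal_losing_def
proof (intro conjI assms allI impI)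
  fix C assume C: "C \<notin> v \<and> shift_le B C"
  obtain w where w: "\<And>j. 0 < gap j w" "\<And>C. \<lbrakk>C \<notin> v; C \<noteq> B\<rbrakk> \<Longrightarrow> weight w C < weight w B"
    using essential_Inl_point[OF assms(2)] by metis
  have "weight w B \<le> weight w C"
    using C w by (intro shift_le_weight) (auto simp: less_imp_le)
  then show "C = B"
    using w(2)[of C] C by force
qed

end

subsection \<open>Dummies and symmetry classes\<close>

lemma finite_minimal_winning_subset:
  fixes A :: "'n::finite set"
  assumes "A \<in> W"
  shows "\<exists>B\<subseteq>A. minimal_winning W B"
proof -
  have "\<exists>B\<in>{B \<in> W. B \<subseteq> A}. \<forall>C\<in>{B \<in> W. B \<subseteq> A}. C \<subseteq> B \<longrightarrow> B = C"
    using assms by (intro finite_has_minimal) auto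
  then obtain B where B: "B \<in> W" "B \<subseteq> A" "\<And>C. \<lbrakk>C \<in> W; C \<subseteq> A; C \<subseteq> B\<rbrakk> \<Longrightarrow> B = C"
    by auto
  have "C \<notin> W" if "C \<subset> B" for C
    using B(3)[of C] B(2) that by blast
  with B(1,2) show ?thesis
    by (auto simp: minimal_winning_def)
qed

context weighted_game
begin

text \<open>A minimal winning subset of \<open>A\<close> avoids a dummy \<open>i\<close>, so it
  survives the removal of \<open>i\<close>. Conversely, no member can be removed from a minimal
  winning coalition.\<close>

lemma dummy_iff: "dummy v i \<longleftrightarrow> (\<forall>A\<in>v. A - {i} \<in> v)"
proof
  assume d: "dummy v i"
  show "\<forall>A\<in>v. A - {i} \<in> v"
  proof
    fix A assume "A \<in> v"
    then obtain B where B: "B \<subseteq> A" "minimal_winning v B"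
      using finite_minimal_winning_subset[of A v] by blast
    with d have "B \<subseteq> A - {i}"
      by (auto simp: dummy_def)
    with B(2) show "A - {i} \<in> v"
      using winning_mono by (auto simp: minimal_winning_def)
  qed
next
  assume r: "\<forall>A\<in>v. A - {i} \<in> v"
  have "i \<notin> A" if "minimal_winning v A" for A
  proof
    assume "i \<in> A"
    then have "A - {i} \<subset> A" by auto
    with that r show False
      by (auto simp: minimal_winning_def)
  qed
  then show "dummy v i"
    by (simp add: dummy_def)
qed

lemma same_class_iff:
  "(i, j) \<in> same_class v \<longleftrightarrow>
    (\<forall>S. i \<notin> S \<longrightarrow> j \<notin> S \<longrightarrow> (insert i S \<in> v \<longleftrightarrow> insert j S \<in> v))"
  by (auto simp: same_class_def subset_Diff_insert)

lemma same_classD: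
  "\<lbrakk>(i, j) \<in> same_class v; i \<notin> S; j \<notin> S\<rbrakk> \<Longrightarrow> insert i S \<in> v \<longleftrightarrow> insert j S \<in> v"
  by (simp add: same_class_iff)

text \<open>The ordered weights of a realization make the exchange of \<open>i\<close> for a later
  voter harmless. Through this exchange the order of the voters acts on classes and dummies.\<close>

lemma winning_swap:
  assumes "i \<le> j" "j \<notin> S" "insert i S \<in> v"
  shows "insert j S \<in> v"
proof (cases "i \<in> S")
  case True
  with assms(3) show ?thesis
    using winning_mono[of "insert i S" "insert j S"] by auto
next
  case False
  obtain q w where s: "strict_realization v (q, w)"
    by (rule strict_point)
  then have "w $ i \<le> w $ j"
    using assms(1) by (intro monotone_of_gap_nonneg) (auto simp: strict_realization_iff less_imp_le)
  then have le: "weight w (insert i S) \<le> weight w (insert j S)"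
    using False assms(2) by (simp add: weight_def)
  show ?thesis
  proof (rule ccontr)
    assume "insert j S \<notin> v"
    with s assms(3) have "weight w (insert j S) < q" "q < weight w (insert i S)"
      by (simp_all add: strict_realization_iff)
    with le show False by simp
  qed
qed

lemma equiv_same_class: "equiv UNIV (same_class v)"
proof (rule equivI)
  show "sym (same_class v)"
    by (auto simp: sym_def same_class_iff)
  show "refl (same_class v)"
    by (auto simp: refl_on_def same_class_iff)
  show "trans (same_class v)"
  proof (rule transI)
    fix i j l assume ij: "(i, j) \<in> same_class v" and jl: "(j, l) \<in> same_class v"
    show "(i, l) \<in> same_class v"
    proof (cases "i = j \<or> j = l \<or> i = l")
      case True
      with ij jl show ?thesis by (auto simp: same_class_iff)
    next
      case False
      show ?thesis
        unfolding same_class_iff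
      proof (intro allI impI)
        fix S assume S: "i \<notin> S" "l \<notin> S"
        show "insert i S \<in> v \<longleftrightarrow> insert l S \<in> v"
        proof (cases "j \<in> S")
          \<comment> \<open>As \<open>j\<close> lies in \<open>S\<close>, neither relation applies
            to \<open>S\<close> itself. Writing \<open>T\<close> for \<open>S\<close> without
            \<open>j\<close>, first \<open>j\<close> is traded for \<open>l\<close> in the presence
            of \<open>i\<close>, then \<open>i\<close> for \<open>j\<close> in the presence of
            \<open>l\<close>.\<close>
          case True
          define T where "T = S - {j}"
          have T: "S = insert j T" "j \<notin> T" "i \<notin> T" "l \<notin> T"
            using S True by (auto simp: T_def)
          have "insert i S \<in> v \<longleftrightarrow> insert l (insert i T) \<in> v"
            using same_classD[OF jl, of "insert i T"] T False by (auto simp: insert_commute)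
          also have "\<dots> \<longleftrightarrow> insert l S \<in> v"
            using same_classD[OF ij, of "insert l T"] T False by (simp add: insert_commute)
          finally show ?thesis .
        next
          case False
          with same_classD[OF ij, of S] same_classD[OF jl, of S] S show ?thesis by simp
        qed
      qed
    qed
  qed
qed auto

text \<open>A voter between two interchangeable ones is squeezed by \<open>winning_swap\<close> from
  both sides. Classes are thus intervals, and comparing a voter with its predecessor detects whether
  it is the least of its class.\<close>

lemma same_class_convex:
  assumes "(i, j) \<in> same_class v" "i \<le> l" "l \<le> j"
  shows "(l, j) \<in> same_class v"
proof (cases "i = l \<or> l = j")
  case True
  with assms(1) show ?thesis
    by (auto simp: same_class_iff)
next
  case False
  with assms have ne: "i \<noteq> l" "l \<noteq> j" "i \<noteq> j" by auto
  show ?thesis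
    unfolding same_class_iff
  proof (intro allI impI iffI)
    fix S assume S: "l \<notin> S" "j \<notin> S"
    { assume "insert l S \<in> v"
      then show "insert j S \<in> v"
        using winning_swap assms(3) S by auto }
    assume jS: "insert j S \<in> v"
    show "insert l S \<in> v"
    proof (cases "i \<in> S")
      case False
      then have "insert i S \<in> v"
        using same_classD[OF assms(1), of S] S jS by simp
      then show ?thesis
        using winning_swap assms(2) S by auto
    next
      \<comment> \<open>Here \<open>i\<close> cannot be inserted afresh. Instead the
        \<open>i\<close> in the coalition is replaced by \<open>l\<close>, and then \<open>j\<close>
        by \<open>i\<close>.\<close>
      case True
      define T where "T = S - {i}"
      have T: "S = insert i T" "i \<notin> T" "j \<notin> T" "l \<notin> T"
        using S True by (auto simp: T_def)
      have "insert j (insert i T) \<in> v"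
        using jS T by simp
      then have "insert l (insert j T) \<in> v"
        using winning_swap[OF assms(2), of "insert j T"] T ne by (simp add: insert_commute)
      then have "insert i (insert l T) \<in> v"
        using same_classD[OF assms(1), of "insert l T"] T ne by (simp add: insert_commute)
      then show ?thesis
        using T by (simp add: insert_commute)
    qed
  qed
qed

text \<open>The earlier voter \<open>i\<close> is exchanged for \<open>j\<close>, which can then be
  dropped.\<close>

lemma dummy_downward:
  assumes "dummy v j" "i \<le> j"
  shows "dummy v i"
  unfolding dummy_iff
proof
  fix A assume A: "A \<in> v"
  show "A - {i} \<in> v"
  proof (cases "i \<in> A")
    case i: True
    have "insert j (A - {i} - {j}) \<in> v"
    proof (cases "j \<in> A - {i}")
      case True
      have "A - {j} \<in> v"
        using A assms(1) by (simp add: dummy_iff)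
      moreover have "A - {j} = insert i (A - {i} - {j})"
        using i True by auto
      ultimately show ?thesis
        using winning_swap[OF assms(2), of "A - {i} - {j}"] by simp
    next
      case False
      then have "A = insert i (A - {i} - {j})"
        using i by auto
      with A show ?thesis
        using winning_swap[OF assms(2), of "A - {i} - {j}"] by simp
    qed
    then have "insert j (A - {i} - {j}) - {j} \<in> v"
      using assms(1) by (auto simp: dummy_iff)
    then show ?thesis
      by (rule winning_mono) auto
  next
    case False
    with A show ?thesis by simp
  qed
qed

lemma dummies_same_class:
  assumes "dummy v i" "dummy v j"
  shows "(i, j) \<in> same_class v"
proof -
  have "insert k S \<in> v \<longleftrightarrow> S \<in> v" if "dummy v k" "k \<notin> S" for k S
  proof
    assume "insert k S \<in> v"
    with that(1) have "insert k S - {k} \<in> v"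
      by (simp only: dummy_iff)
    with that(2) show "S \<in> v" by simp
  qed (auto intro: winning_mono)
  with assms show ?thesis
    by (simp add: same_class_iff)
qed

text \<open>From a winning coalition drop \<open>i\<close>, trade \<open>j\<close> for
  \<open>i\<close>, and drop \<open>i\<close> again. With \<open>dummies_same_class\<close>, the
  dummies, if any, form a single class.\<close>

lemma dummy_same_class:
  assumes "dummy v i" "(i, j) \<in> same_class v"
  shows "dummy v j"
  unfolding dummy_iff
proof
  fix A assume A: "A \<in> v"
  define T where "T = A - {j} - {i}"
  show "A - {j} \<in> v"
  proof (cases "j \<in> A")
    case True
    have "A - {i} \<in> v"
      using A assms(1) by (simp add: dummy_iff)
    then have "insert j T \<in> v"
      by (rule winning_mono) (auto simp: T_def)
    then have "insert i T \<in> v"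
      using same_classD[OF assms(2), of T] by (simp add: T_def)
    then have "insert i T - {i} \<in> v"
      using assms(1) by (simp only: dummy_iff)
    then show ?thesis
      by (rule winning_mono) (auto simp: T_def)
  next
    case False
    with A show ?thesis by simp
  qed
qed

section \<open>Essential simplex inequalities\<close>

lemma essential_InrI:
  assumes "(\<Sum>i\<in>UNIV. w $ i) = 1" "gap j w = 0" "\<And>l. l \<noteq> j \<Longrightarrow> 0 < gap l w"
    and "\<And>A. A \<in> v \<Longrightarrow> q < weight w A" "\<And>A. A \<notin> v \<Longrightarrow> weight w A < q"
  shows "Inr j \<in> essential"
proof -
  have "0 < slack v i (q, w)" if "i \<noteq> Inr j" for i
    using that assms(3-5) by (cases i) (auto simp: slack_Inl)
  with assms(1,2) show ?thesis
    by (auto simp: essential_def mem_weight_space intro!: bexI[of _ "(q, w)"])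
qed

lemma essential_Inr_point:
  assumes "Inr j \<in> essential"
  obtains q w where "(\<Sum>i\<in>UNIV. w $ i) = 1" "gap j w = 0" "\<And>l. l \<noteq> j \<Longrightarrow> 0 < gap l w"
    and "\<And>A. A \<in> v \<longleftrightarrow> q \<le> weight w A"
proof -
  obtain q w where x: "(q, w) \<in> weight_space" "slack v (Inr j) (q, w) = 0"
    and pos: "\<And>i. i \<noteq> Inr j \<Longrightarrow> 0 < slack v i (q, w)"
    using assms by (auto simp: essential_def)
  have "0 < gap l w" if "l \<noteq> j" for l
    using pos[of "Inr l"] that by simp
  moreover have "A \<in> v \<longleftrightarrow> q \<le> weight w A" for A
    using pos[of "Inl A"] by (simp add: slack_Inl split: if_splits)
  ultimately show ?thesis
    using that[of w q] x by (simp add: mem_weight_space)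
qed

text \<open>A voter of weight 0 is a dummy. Conversely, the weight of a dummy can be erased, since
  removing it changes no coalition's status; quota and remaining weights are then rescaled to total
  weight 1.\<close>

lemma essential_zero_weight_iff: "Inr (Min UNIV) \<in> essential \<longleftrightarrow> dummy v (Min UNIV)"
proof
  assume "Inr (Min UNIV) \<in> essential"
  then obtain q w where w: "gap (Min UNIV) w = 0" and A: "\<And>A. A \<in> v \<longleftrightarrow> q \<le> weight w A"
    using essential_Inr_point by metis
  have "weight w (A - {Min UNIV}) = weight w A" for A
    using w by (simp add: weight_def gap_def sum_diff1)
  then show "dummy v (Min UNIV)"
    by (simp add: dummy_iff A)
next
  assume d: "dummy v (Min UNIV)"
  let ?m = "Min UNIV :: 'n"
  obtain q w where s: "strict_realization v (q, w)"
    by (rule strict_point)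
  then have w: "(\<Sum>i\<in>UNIV. w $ i) = 1" "\<And>j. 0 < gap j w"
      "\<And>A. A \<in> v \<Longrightarrow> q < weight w A" "\<And>A. A \<notin> v \<Longrightarrow> weight w A < q"
    by (simp_all add: strict_realization_iff)
  \<comment> \<open>The normalizing constant is positive because everyone but the dummy still wins
    and hence exceeds the positive quota.\<close>
  define c where "c = weight w (UNIV - {?m})"
  have "UNIV - {?m} \<in> v"
    using d UNIV_winning by (simp only: dummy_iff)
  then have "0 < c"
    using w(3)[of "UNIV - {?m}"] w(4)[OF empty_losing] by (simp add: c_def)
  define w' where "w' = (\<chi> i. if i = ?m then 0 else w $ i / c)"
  have weight': "weight w' A = weight w (A - {?m}) / c" for A
  proof -
    have "weight w' A = (\<Sum>i\<in>A - {?m}. w' $ i)"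
      unfolding weight_def by (rule sum.mono_neutral_right) (auto simp: w'_def)
    also have "\<dots> = (\<Sum>i\<in>A - {?m}. w $ i / c)"
      by (rule sum.cong) (auto simp: w'_def)
    finally show ?thesis
      by (simp add: weight_def sum_divide_distrib)
  qed
  show "Inr ?m \<in> essential"
  proof (rule essential_InrI)
    show "(\<Sum>i\<in>UNIV. w' $ i) = 1"
      using weight'[of UNIV] \<open>0 < c\<close> by (simp add: weight_UNIV c_def)
    show "gap ?m w' = 0"
      by (simp add: gap_def w'_def)
    show "0 < gap l w'" if l: "l \<noteq> ?m" for l
      using increasing_of_gap_pos[OF less_imp_le[OF w(2)] w(2) predecessor_less[OF l]]
        pos_of_gap_pos[OF w(2), of l] l \<open>0 < c\<close>
      by (simp add: gap_def w'_def divide_strict_right_mono)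
    show "q / c < weight w' A" if "A \<in> v" for A
      using w(3)[of "A - {?m}"] d that \<open>0 < c\<close>
      by (simp add: weight' dummy_iff divide_strict_right_mono)
    show "weight w' A < q / c" if "A \<notin> v" for A
    proof -
      have "A - {?m} \<notin> v"
        using that winning_mono[of "A - {?m}" A] by auto
      then show ?thesis
        using w(4) \<open>0 < c\<close> by (simp add: weight' divide_strict_right_mono)
    qed
  qed
qed

text \<open>Averaging the weights of two interchangeable neighbours keeps the realization strict in every
  inequality other than theirs.\<close>

lemma essential_equal_weights_iff:
  assumes j: "j \<noteq> Min UNIV"
  shows "Inr j \<in> essential \<longleftrightarrow> (predecessor j, j) \<in> same_class v"
proof
  assume "Inr j \<in> essential"
  then obtain q w where w: "gap j w = 0" and A: "\<And>A. A \<in> v \<longleftrightarrow> q \<le> weight w A"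
    using essential_Inr_point by metis
  have "w $ predecessor j = w $ j"
    using w j by (simp add: gap_def)
  then show "(predecessor j, j) \<in> same_class v"
    by (simp add: same_class_iff A weight_def)
next
  let ?p = "predecessor j"
  assume sc: "(?p, j) \<in> same_class v"
  have p: "?p < j" "\<And>i. i < j \<Longrightarrow> i \<le> ?p"
    using predecessor[OF j] by auto
  obtain q w where s: "strict_realization v (q, w)"
    by (rule strict_point)
  then have w: "(\<Sum>i\<in>UNIV. w $ i) = 1" "\<And>j. 0 < gap j w"
      "\<And>A. A \<in> v \<Longrightarrow> q < weight w A" "\<And>A. A \<notin> v \<Longrightarrow> weight w A < q"
    by (simp_all add: strict_realization_iff)
  have less: "w $ i < w $ l" if "i < l" for i l
    using increasing_of_gap_pos[OF less_imp_le[OF w(2)] w(2) that] .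
  have pos: "0 < w $ i" for i
    using w(2) by (rule pos_of_gap_pos)
  define t where "t = Transposition.transpose ?p j"
  define w' where "w' = (\<chi> i. (w $ i + w $ t i) / 2)"
  have weight': "weight w' A = (weight w A + weight w (t ` A)) / 2" for A
  proof -
    have "weight w (t ` A) = (\<Sum>i\<in>A. w $ t i)"
      unfolding weight_def t_def by (subst sum.reindex) auto
    then show ?thesis
      by (simp add: weight_def w'_def sum.distrib flip: sum_divide_distrib)
  qed
  \<comment> \<open>The transposition preserves winning, so \<open>A\<close> and its image lie on
    the same side of the quota, and so does the average of their weights.\<close>
  have swap: "t ` A \<in> v \<longleftrightarrow> A \<in> v" for A
  proof -
    define S where "S = A - {?p, j}"
    have tS: "t ` S = S"
      by (force simp: S_def t_def Transposition.transpose_def)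
    have tp: "t ?p = j" "t j = ?p"
      by (auto simp: t_def)
    have S: "?p \<notin> S" "j \<notin> S"
      by (auto simp: S_def)
    have "A = S \<or> A = insert ?p S \<or> A = insert j S \<or> A = insert ?p (insert j S)"
      by (auto simp: S_def)
    then show ?thesis
      using same_classD[OF sc S] by (elim disjE) (auto simp: tS tp insert_commute)
  qed
  show "Inr j \<in> essential"
  proof (rule essential_InrI)
    show "(\<Sum>i\<in>UNIV. w' $ i) = 1"
    proof -
      have "t ` UNIV = UNIV"
        by (simp add: t_def)
      with weight'[of UNIV] w(1) show ?thesis
        by (simp add: weight_UNIV)
    qed
    show "gap j w' = 0"
      using j by (simp add: gap_def w'_def t_def)
    show "0 < gap l w'" if l: "l \<noteq> j" for l
    proof (cases "l = Min UNIV")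
      case True
      then show ?thesis
        using pos[of l] pos[of "t l"] by (simp add: gap_def w'_def)
    next
      case False
      define r where "r = predecessor l"
      have r: "r < l" "\<And>i. i < l \<Longrightarrow> i \<le> r"
        using predecessor[OF False] by (auto simp: r_def)
      \<comment> \<open>The transposition reverses a consecutive pair only if it is the transposed
        pair itself, and \<open>j\<close> is the only voter preceded by \<open>?p\<close>.\<close>
      have "r \<noteq> ?p"
        using r(1) r(2)[of j] p(1) p(2)[of l] l by (metis leD linorder_neqE)
      have "w $ r < w $ l"
        using less r(1) by simp
      moreover have "w $ t r < w $ t l"
      proof -
        have "t r < t l"
        proof (cases "l = ?p")
          case True
          then show ?thesis
            using r(1) p(1) by (auto simp: t_def Transposition.transpose_def)
        next
          case False
          then show ?thesis
            using r(1) p(1) l \<open>r \<noteq> ?p\<close> by (auto simp: t_def Transposition.transpose_def)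
        qed
        then show ?thesis by (rule less)
      qed
      ultimately show ?thesis
        using False by (simp add: gap_def w'_def r_def[symmetric] field_simps)
    qed
    show "q < weight w' A" if "A \<in> v" for A
      using w(3)[of A] w(3)[of "t ` A"] swap[of A] that by (simp add: weight')
    show "weight w' A < q" if "A \<notin> v" for A
      using w(4)[of A] w(4)[of "t ` A"] swap[of A] that by (simp add: weight')
  qed
qed

text \<open>The weights of a point witnessing that \<open>Inr j\<close> is essential for the game
  show the same for the simplex. Conversely, over a simplex facet some gap vanishes, and
  \<open>essential_vanishing\<close> identifies the index.\<close>

lemma vertical_facets_eq: "vertical_facets v = (\<lambda>j. tight (Inr j)) ` {j. Inr j \<in> essential}"
  and vertical_facet_in_simplex_facet:
    "Inr j \<in> essential \<Longrightarrow>
      simplex.tight j facet_of weight_simplex \<and> tight (Inr j) \<subseteq> UNIV \<times> simplex.tight j"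
proof -
  show simplex: "simplex.tight j facet_of weight_simplex \<and> tight (Inr j) \<subseteq> UNIV \<times> simplex.tight j"
    if j: "Inr j \<in> essential" for j
  proof
    obtain w where "(\<Sum>i\<in>UNIV. w $ i) = 1" "gap j w = 0" "\<And>l. l \<noteq> j \<Longrightarrow> 0 < gap l w"
      using essential_Inr_point[OF j] by metis
    then have "j \<in> simplex.essential"
      unfolding simplex.essential_def by auto
    then show "simplex.tight j facet_of weight_simplex"
      unfolding simplex_solutions[symmetric] by (rule simplex.tight_facet)
    show "tight (Inr j) \<subseteq> UNIV \<times> simplex.tight j"
      by (auto simp: tight_def solutions_def simplex.tight_def simplex_solutions weight_simplex_eq
          mem_weight_space all_slack_iff[of "\<lambda>t. 0 \<le> t"])
  qed
  show "vertical_facets v = (\<lambda>j. tight (Inr j)) ` {j. Inr j \<in> essential}"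
  proof
    show "vertical_facets v \<subseteq> (\<lambda>j. tight (Inr j)) ` {j. Inr j \<in> essential}"
    proof
      fix F assume "F \<in> vertical_facets v"
      then obtain i \<tau> where i: "i \<in> essential" "F = tight i"
        and \<tau>: "\<tau> facet_of weight_simplex" "F \<subseteq> UNIV \<times> \<tau>"
        by (auto simp: vertical_facets_def facets_eq)
      from \<tau>(1) obtain j where j: "\<tau> = simplex.tight j"
        unfolding simplex_solutions[symmetric] simplex.facet_of_solutions_iff by auto
      have "slack v (Inr j) x = 0" if "x \<in> tight i" for x
        using that \<tau>(2) i j by (auto simp: simplex.tight_def)
      from essential_vanishing[OF i(1) UNIV_I this] i
      show "F \<in> (\<lambda>j. tight (Inr j)) ` {j. Inr j \<in> essential}"
        by auto
    qed
    show "(\<lambda>j. tight (Inr j)) ` {j. Inr j \<in> essential} \<subseteq> vertical_facets v"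
      using simplex by (auto simp: vertical_facets_def facets_eq)
  qed
qed

text \<open>The right side says that \<open>j\<close> is the least member of a nontrivial class. By
  convexity the predecessor alone decides this, and a dummy other than the least voter is
  interchangeable with its predecessor.\<close>

lemma class_leader_iff:
  "Inr j \<notin> essential \<longleftrightarrow> \<not> dummy v j \<and> (\<forall>i<j. (i, j) \<notin> same_class v)"
proof (cases "j = Min UNIV")
  case True
  have "\<not> i < j" for i
    using Min_UNIV_le[of i] by (simp only: True not_less)
  then show ?thesis
    using True by (simp add: essential_zero_weight_iff del: Min_gr_iff Min_ge_iff)
next
  case False
  note p = predecessor[OF False]
  show ?thesis
  proof
    assume "Inr j \<notin> essential"
    then have n: "(predecessor j, j) \<notin> same_class v"
      using False by (simp add: essential_equal_weights_iff)
    have "\<not> dummy v j"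
      using n dummies_same_class dummy_downward[of j "predecessor j"] less_imp_le[OF p(1)] by auto
    moreover have "(i, j) \<notin> same_class v" if "i < j" for i
      using n same_class_convex[of i j "predecessor j"] less_imp_le[OF p(1)] p(2)[OF that] by auto
    ultimately show "\<not> dummy v j \<and> (\<forall>i<j. (i, j) \<notin> same_class v)" by simp
  next
    assume "\<not> dummy v j \<and> (\<forall>i<j. (i, j) \<notin> same_class v)"
    with p(1) show "Inr j \<notin> essential"
      using False by (simp add: essential_equal_weights_iff)
  qed
qed

lemma card_nontrivial_classes: "card (nontrivial_classes v) = card {j. Inr j \<notin> essential}"
proof -
  let ?L = "{j. Inr j \<notin> essential}"
  let ?c = "\<lambda>j. same_class v `` {j}"
  note eq = eq_equiv_class_iff[OF equiv_same_class UNIV_I UNIV_I]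
  have "inj_on ?c ?L"
  proof (rule inj_onI)
    fix i j assume ij: "i \<in> ?L" "j \<in> ?L" and "?c i = ?c j"
    then have "(i, j) \<in> same_class v" "(j, i) \<in> same_class v"
      unfolding eq by (auto dest: symD[OF equiv_same_class[THEN equivE]] simp: same_class_iff)
    with ij show "i = j"
      by (auto simp: class_leader_iff dest: linorder_neqE)
  qed
  moreover have "?c ` ?L = nontrivial_classes v"
  proof
    show "?c ` ?L \<subseteq> nontrivial_classes v"
      by (auto simp: nontrivial_classes_def class_leader_iff intro: quotientI)
    show "nontrivial_classes v \<subseteq> ?c ` ?L"
    proof
      fix C assume "C \<in> nontrivial_classes v"
      then obtain i where i: "\<not> dummy v i" "C = ?c i"
        by (auto simp: nontrivial_classes_def elim: quotientE)
      \<comment> \<open>The least member represents its class; any smaller voter in the same class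
        would contradict minimality.\<close>
      define j where "j = Min C"
      have "i \<in> C"
        using i equiv_class_self[OF equiv_same_class] by auto
      then have "j \<in> C"
        unfolding j_def by (intro Min_in) auto
      then have ij: "(i, j) \<in> same_class v"
        using i by simp
      then have cj: "C = ?c j"
        unfolding i(2) eq .
      have "\<not> dummy v j"
        using i(1) dummy_same_class[of j i] ij by (auto simp: same_class_iff)
      moreover have "(l, j) \<notin> same_class v" if "l < j" for l
      proof
        assume "(l, j) \<in> same_class v"
        then have "l \<in> C"
          unfolding cj by (auto simp: same_class_iff)
        then have "j \<le> l"
          unfolding j_def by (intro Min_le) auto
        with that show False by simp
      qed
      ultimately have "j \<in> ?L"
        by (simp add: class_leader_iff)
      with cj show "C \<in> ?c ` ?L" by blast
    qed
  qed
  ultimately show ?thesis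
    using card_image by force
qed

end

subsection \<open>Counting the facets\<close>

context weighted_game
begin

lemma bij_top: "bij_betw (\<lambda>A. tight (Inl A)) {A \<in> v. Inl A \<in> essential} (top_facets v)"
  using inj_on_tight by (auto simp: bij_betw_def top_facets_eq inj_on_def)

lemma bij_bottom: "bij_betw (\<lambda>A. tight (Inl A)) {A. A \<notin> v \<and> Inl A \<in> essential} (bottom_facets v)"
  using inj_on_tight by (auto simp: bij_betw_def bottom_facets_eq inj_on_def)

lemma bij_vertical: "bij_betw (\<lambda>j. tight (Inr j)) {j. Inr j \<in> essential} (vertical_facets v)"
  using inj_on_tight by (auto simp: bij_betw_def vertical_facets_eq inj_on_def)

lemma bij_covers:
  assumes "v \<noteq> unanimity_game"
  shows "bij_betw (\<lambda>A. v - {A}) {A \<in> v. Inl A \<in> essential} {u. covers u v}"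
proof -
  have "A \<noteq> UNIV" if "Inl A \<in> essential" for A
    using that assms essential_UNIV_iff by auto
  then have "{u. covers u v} = (\<lambda>A. v - {A}) ` {A \<in> v. Inl A \<in> essential}"
    by (auto simp: covers_iff)
  moreover have "inj_on (\<lambda>A. v - {A}) {A \<in> v. Inl A \<in> essential}"
    by (auto simp: inj_on_def)
  ultimately show ?thesis
    by (simp add: bij_betw_def)
qed

lemma bij_covered:
  assumes "v \<noteq> any_voter_game"
  shows "bij_betw (\<lambda>B. insert B v) {B. B \<notin> v \<and> Inl B \<in> essential} {g. covers v g}"
proof -
  have "B \<noteq> {}" if "Inl B \<in> essential" for B
    using that assms essential_empty_iff by auto
  then have "{g. covers v g} = (\<lambda>B. insert B v) ` {B. B \<notin> v \<and> Inl B \<in> essential}"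
    by (auto simp: covered_iff)
  moreover have "inj_on (\<lambda>B. insert B v) {B. B \<notin> v \<and> Inl B \<in> essential}"
    by (auto simp: inj_on_def)
  ultimately show ?thesis
    by (simp add: bij_betw_def)
qed

lemma top_indices_unanimity:
  assumes "v = unanimity_game"
  shows "{A \<in> v. Inl A \<in> essential} = {UNIV}" "{u. covers u v} = {}"
proof -
  have only: "A = UNIV" if "A \<in> v" for A
    using that assms by (simp add: unanimity_game_def)
  have "Inl UNIV \<in> essential"
    unfolding essential_UNIV_iff by (rule assms)
  with only show "{A \<in> v. Inl A \<in> essential} = {UNIV}"
    using UNIV_winning by auto
  show "{u. covers u v} = {}"
    unfolding covers_iff using only by auto
qed

lemma bottom_indices_any_voter:
  assumes "v = any_voter_game"
  shows "{A. A \<notin> v \<and> Inl A \<in> essential} = {{}}" "{g. covers v g} = {}"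
proof -
  have only: "A = {}" if "A \<notin> v" for A
    using that assms by (simp add: any_voter_game_def)
  have "Inl {} \<in> essential"
    unfolding essential_empty_iff by (rule assms)
  with only show "{A. A \<notin> v \<and> Inl A \<in> essential} = {{}}"
    using empty_losing by auto
  show "{g. covers v g} = {}"
    unfolding covered_iff using only by auto
qed

text \<open>The top facet of the unanimity game corresponds to no covering game, whence the
  correction term.\<close>

lemma card_top_indices:
  "card {A \<in> v. Inl A \<in> essential} = card {u. covers u v} + (if v = unanimity_game then 1 else 0)"
  using bij_betw_same_card[OF bij_covers] top_indices_unanimity by (cases "v = unanimity_game") auto

lemma card_bottom_indices:
  "card {A. A \<notin> v \<and> Inl A \<in> essential} = card {g. covers v g} + (if v = any_voter_game then 1 else 0)"
  using bij_betw_same_card[OF bij_covered] bottom_indices_any_voter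
  by (cases "v = any_voter_game") auto

lemma card_vertical_indices: "card {j. Inr j \<in> essential} + card (nontrivial_classes v) = CARD('n)"
proof -
  have "card ({j. Inr j \<in> essential} \<union> {j. Inr j \<notin> essential}) =
      card {j. Inr j \<in> essential} + card {j. Inr j \<notin> essential}"
    by (rule card_Un_disjoint) auto
  moreover have "{j. Inr j \<in> essential} \<union> {j. Inr j \<notin> essential} = UNIV"
    by auto
  ultimately show ?thesis
    by (simp add: card_nontrivial_classes)
qed

lemma card_facets:
  "card (facets v) = card {A \<in> v. Inl A \<in> essential} + card {A. A \<notin> v \<and> Inl A \<in> essential} +
    card {j. Inr j \<in> essential}"
proof -
  let ?T = "{A \<in> v. Inl A \<in> essential}" and ?B = "{A. A \<notin> v \<and> Inl A \<in> essential}"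
    and ?V = "{j. Inr j \<in> essential}"
  have "essential = (?T \<union> ?B) <+> ?V"
  proof (rule set_eqI)
    fix i show "i \<in> essential \<longleftrightarrow> i \<in> (?T \<union> ?B) <+> ?V"
      by (cases i) auto
  qed
  then have "card essential = card ((?T \<union> ?B) <+> ?V)"
    by (rule arg_cong)
  also have "\<dots> = card (?T \<union> ?B) + card ?V"
    by (rule card_Plus) auto
  also have "card (?T \<union> ?B) = card ?T + card ?B"
    by (rule card_Un_disjoint) auto
  finally show ?thesis
    by (simp add: facets_eq card_image inj_on_tight)
qed

section \<open>Correspondences between facets and neighbouring games\<close>

lemma top_correspondence:
  assumes "v \<noteq> unanimity_game"
  shows "\<exists>\<phi>. bij_betw \<phi> {u. covers u v} (top_facets v) \<and>
    (\<forall>u. covers u v \<longrightarrow>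
      (\<exists>A. v - u = {A} \<and> \<phi> u \<subseteq> coalition_hyperplane A \<and> shift_minimal_winning v A))"
proof (rule exI, intro conjI allI impI)
  let ?\<phi> = "\<lambda>u. tight (Inl (the_elem (v - u)))"
  have elem: "v - (v - {A}) = {A}" if "A \<in> v" for A
    using that by auto
  \<comment> \<open>Games and facets are both indexed by the essential winning coalitions; the map
    sends \<open>u\<close> to the facet of the coalition that \<open>u\<close> loses, so composed
    with the indexing of games it gives the indexing of facets.\<close>
  have "bij_betw (?\<phi> \<circ> (\<lambda>A. v - {A})) {A \<in> v. Inl A \<in> essential} (top_facets v)"
    using bij_top by (rule bij_betw_cong[THEN iffD1, rotated]) (simp add: elem)
  then show "bij_betw ?\<phi> {u. covers u v} (top_facets v)"
    by (rule bij_betw_comp_iff[OF bij_covers[OF assms], THEN iffD2])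
  fix u assume "covers u v"
  then obtain A where A: "A \<in> v" "Inl A \<in> essential" "u = v - {A}"
    by (auto simp: covers_iff)
  then show "\<exists>A. v - u = {A} \<and> ?\<phi> u \<subseteq> coalition_hyperplane A \<and> shift_minimal_winning v A"
    using tight_Inl_subset essential_shift_minimal by (intro exI[of _ A]) (simp add: elem)
qed

lemma bottom_correspondence:
  assumes "v \<noteq> any_voter_game"
  shows "\<exists>\<psi>. bij_betw \<psi> {g. covers v g} (bottom_facets v) \<and>
    (\<forall>g. covers v g \<longrightarrow>
      (\<exists>B. g - v = {B} \<and> \<psi> g \<subseteq> coalition_hyperplane B \<and> shift_maximal_losing v B))"
proof (rule exI, intro conjI allI impI)
  let ?\<psi> = "\<lambda>g. tight (Inl (the_elem (g - v)))"
  have elem: "insert B v - v = {B}" if "B \<notin> v" for B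
    using that by auto
  have "bij_betw (?\<psi> \<circ> (\<lambda>B. insert B v)) {B. B \<notin> v \<and> Inl B \<in> essential} (bottom_facets v)"
    using bij_bottom by (rule bij_betw_cong[THEN iffD1, rotated]) (simp add: elem)
  then show "bij_betw ?\<psi> {g. covers v g} (bottom_facets v)"
    by (rule bij_betw_comp_iff[OF bij_covered[OF assms], THEN iffD2])
  fix g assume "covers v g"
  then obtain B where B: "B \<notin> v" "Inl B \<in> essential" "g = insert B v"
    by (auto simp: covered_iff)
  then show "\<exists>B. g - v = {B} \<and> ?\<psi> g \<subseteq> coalition_hyperplane B \<and> shift_maximal_losing v B"
    using tight_Inl_subset essential_shift_maximal by (intro exI[of _ B]) (simp add: elem)
qed

lemma top_facets_unanimity:
  assumes "v = unanimity_game"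
  shows "\<exists>F. top_facets v = {F} \<and> F \<subseteq> {(q, w). q = 1}"
proof (intro exI conjI)
  show "top_facets v = {tight (Inl UNIV)}"
    by (simp add: top_facets_eq top_indices_unanimity(1)[OF assms])
  show "tight (Inl UNIV) \<subseteq> {(q, w). q = 1}"
    using tight_Inl_subset[of UNIV] by (auto simp: coalition_hyperplane_def weight_UNIV)
qed

lemma bottom_facets_any_voter:
  assumes "v = any_voter_game"
  shows "\<exists>F. bottom_facets v = {F} \<and> F \<subseteq> {(q, w). q = 0}"
proof (intro exI conjI)
  show "bottom_facets v = {tight (Inl {})}"
    by (simp add: bottom_facets_eq bottom_indices_any_voter(1)[OF assms])
  show "tight (Inl {}) \<subseteq> {(q, w). q = 0}"
    using tight_Inl_subset[of "{}"] by (auto simp: coalition_hyperplane_def)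
qed

lemma vertical_facet_over_face:
  assumes "F \<in> vertical_facets v"
  shows "\<exists>\<tau>. \<tau> facet_of weight_simplex \<and> F \<subseteq> UNIV \<times> \<tau> \<and>
    ((\<exists>i j. consecutive i j \<and> \<tau> = equal_weights_face i j) \<or> \<tau> = zero_weight_face)"
proof -
  obtain j where j: "Inr j \<in> essential" "F = tight (Inr j)"
    using assms by (auto simp: vertical_facets_eq)
  have "(\<exists>i k. consecutive i k \<and> simplex.tight j = equal_weights_face i k) \<or>
      simplex.tight j = zero_weight_face"
    by (cases "j = Min UNIV") (auto simp: simplex_tight consecutive_iff)
  with j vertical_facet_in_simplex_facet[OF j(1)] show ?thesis
    by (intro exI[of _ "simplex.tight j"]) simp
qed

end

theorem theorem4p13:
  fixes v :: "'n::{finite,linorder} set set" and n k d :: nat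
  assumes "weighted v"
    and "n = CARD('n)"
    and "k = card (nontrivial_classes v)"
    and "d = degree v"
  shows
    "finite (facets v) \<and>
     int (card (facets v)) = int n - int k + int d +
       (if v = unanimity_game then 1 else 0) + (if v = any_voter_game then 1 else 0) \<and>
     (v \<noteq> unanimity_game \<longrightarrow>
        (\<exists>\<phi>. bij_betw \<phi> {u. covers u v} (top_facets v) \<and>
             (\<forall>u. covers u v \<longrightarrow>
                (\<exists>A. v - u = {A} \<and> \<phi> u \<subseteq> coalition_hyperplane A \<and> shift_minimal_winning v A)))) \<and>
     (v = unanimity_game \<longrightarrow> (\<exists>F. top_facets v = {F} \<and> F \<subseteq> {(q, w). q = 1})) \<and>
     (v \<noteq> any_voter_game \<longrightarrow>
        (\<exists>\<psi>. bij_betw \<psi> {g. covers v g} (bottom_facets v) \<and>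
             (\<forall>g. covers v g \<longrightarrow>
                (\<exists>B. g - v = {B} \<and> \<psi> g \<subseteq> coalition_hyperplane B \<and> shift_maximal_losing v B)))) \<and>
     (v = any_voter_game \<longrightarrow> (\<exists>F. bottom_facets v = {F} \<and> F \<subseteq> {(q, w). q = 0})) \<and>
     finite (vertical_facets v) \<and> int (card (vertical_facets v)) = int n - int k \<and>
     (\<forall>F \<in> vertical_facets v.
        \<exists>\<tau>. \<tau> facet_of weight_simplex \<and> F \<subseteq> UNIV \<times> \<tau> \<and>
            ((\<exists>i j. consecutive i j \<and> \<tau> = equal_weights_face i j) \<or> \<tau> = zero_weight_face))"
proof -
  interpret weighted_game v
    by unfold_locales (rule assms(1))
  have nk: "int (card {j. Inr j \<in> essential}) = int n - int k"
    using card_vertical_indices assms(2,3) by simp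
  have "finite (facets v)"
    by (simp add: facets_eq)
  moreover have "int (card (facets v)) = int n - int k + int d +
       (if v = unanimity_game then 1 else 0) + (if v = any_voter_game then 1 else 0)"
    using card_facets card_top_indices card_bottom_indices nk assms(4)
    by (simp add: degree_def)
  moreover have "finite (vertical_facets v)"
    by (simp add: vertical_facets_eq)
  moreover have "int (card (vertical_facets v)) = int n - int k"
    using bij_betw_same_card[OF bij_vertical] nk by simp
  ultimately show ?thesis
    using top_correspondence top_facets_unanimity bottom_correspondence bottom_facets_any_voter
      vertical_facet_over_face
    by simp
qed

end
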